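(* Let $A\subset\mathbb{R}^d$ be a bounded set such that $\partial A$ is $(\mathcal{H}^{d-1},d-1)$-rectifiable. Let $M\in\mathbb{R}^{d\times d}$ be a rotation matrix and let $w=\max_{a\in\partial A}|a-Ma|$. Then $$\mathcal{H}^d\Bigl(\bigcup\{\ell(a,Ma) : a\in\partial A\}\Bigr)\le w\,\mathcal{H}^{d-1}(\partial A).$$
   Context: Notation: $|\cdot|$ is the Euclidean norm; a rotation matrix is an element of the special orthogonal group $SO(d)\subset\mathbb{R}^{d\times d}$; the boundary $\partial A$ is $\operatorname{cl}(A)\setminus\operatorname{int}(A)$; for $x,y\in\mathbb{R}^d$, $\ell(x,y)=\{(1-\lambda)x+\lambda y : \lambda\in[0,1]\}$ is the line segment from $x$ to $y$. Hausdorff measure: for an integer $0\le k\le d$, let $\omega_k$ denote the volume of the Euclidean unit ball in $\mathbb{R}^k$ (with $\omega_0=1$). For an arbitrary set $A\subset\mathbb{R}^d$ (no measurability required) and $\delta>0$ put $$\mathcal{H}^k_\delta(A)=\omega_k 2^{-k}\inf\Bigl\{\sum_{j=0}^\infty(\operatorname{diam}B_j)^k : B_j\subset\mathbb{R}^d,\ \operatorname{diam}B_j\le\delta \text{ for all } j,\ A\subset\bigcup_{j=0}^\infty B_j\Bigr\},$$ and $\mathcal{H}^k(A)=\lim_{\delta\to 0^+}\mathcal{H}^k_\delta(A)\in[0,\infty]$ (for $k=0$, $(\operatorname{diam} B)^0$ is $1$ for nonempty $B$ and $0$ for $B=\emptyset$, so $\mathcal{H}^0$ is counting measure). With this normalization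 $\mathcal{H}^d$ agrees with Lebesgue measure on Lebesgue measurable subsets of $\mathbb{R}^d$. Rectifiability: a subset $E$ of a metric space is $k$-rectifiable if there is a Lipschitz continuous function mapping some bounded subset of $\mathbb{R}^k$ onto $E$. A union of countably many $k$-rectifiable sets is called countably $k$-rectifiable. $E$ is countably $(\mu,k)$-rectifiable if $\mu$ is a measure defined on $E$ and there is a countably $k$-rectifiable set containing $\mu$-almost all of $E$. If additionally $\mu(E)<\infty$, then $E$ is called $(\mu,k)$-rectifiable. *)

theory Defs
  imports "HOL-Analysis.Analysis"
begin

text \<open>
  Premeasure with size bound \<open>\<delta>\<close>.  The condition \<open>bounded\<close> expresses that the diameter is finite:
  \<^const>\<open>diameter\<close> has an unspecified value on unbounded sets.  The case distinction
  is needed because \<open>diameter {} ^ 0 = 1\<close>, whereas the empty set has to contribute \<open>0\<close> also for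
  \<open>k = 0\<close>.
\<close>

definition hausdorff_delta :: "nat \<Rightarrow> real \<Rightarrow> 'a::metric_space set \<Rightarrow> ennreal" where
  "hausdorff_delta k \<delta> A =
     ennreal (unit_ball_vol (real k) / 2 ^ k) *
     Inf {(\<Sum>j. if B j = {} then 0 else ennreal (diameter (B j) ^ k)) | B :: nat \<Rightarrow> 'a set.
            (\<forall>j. bounded (B j) \<and> diameter (B j) \<le> \<delta>) \<and> A \<subseteq> (\<Union>j. B j)}"

definition hausdorff_measure :: "nat \<Rightarrow> 'a::metric_space set \<Rightarrow> ennreal" where
  "hausdorff_measure k A = Lim (at_right 0) (\<lambda>\<delta>. hausdorff_delta k \<delta> A)"

text \<open>
  The space \<open>\<real>\<^sup>k\<close> for a natural number \<open>k\<close> (possibly \<open>0\<close>) with its Euclidean distance; its points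
  are the real sequences that vanish from index \<open>k\<close> on.
\<close>

definition Rn_metric :: "nat \<Rightarrow> (nat \<Rightarrow> real) metric" where
  "Rn_metric k =
     metric (topspace (Euclidean_space k), \<lambda>x y. L2_set (\<lambda>i. x i - y i) {..<k})"

lemma Metric_space_Euclidean:
  "Metric_space (topspace (Euclidean_space k)) (\<lambda>x y. L2_set (\<lambda>i. x i - y i) {..<k})"
proof
  show "0 \<le> L2_set (\<lambda>i. x i - y i) {..<k}" for x y :: "nat \<Rightarrow> real"
    by simp
  show "L2_set (\<lambda>i. x i - y i) {..<k} = L2_set (\<lambda>i. y i - x i) {..<k}" for x y :: "nat \<Rightarrow> real"
    by (simp add: L2_set_def power2_commute)
  show "L2_set (\<lambda>i. x i - y i) {..<k} = 0 \<longleftrightarrow> x = y"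
    if "x \<in> topspace (Euclidean_space k)" "y \<in> topspace (Euclidean_space k)" for x y
  proof -
    have "x i = y i" if "\<forall>j<k. x j = y j" for i
      using that \<open>x \<in> _\<close> \<open>y \<in> _\<close> by (cases "i < k") (auto simp: topspace_Euclidean_space)
    then show ?thesis
      by (auto simp: L2_set_eq_0_iff)
  qed
  show "L2_set (\<lambda>i. x i - z i) {..<k} \<le>
        L2_set (\<lambda>i. x i - y i) {..<k} + L2_set (\<lambda>i. y i - z i) {..<k}" for x y z :: "nat \<Rightarrow> real"
    using L2_set_triangle_ineq[of "\<lambda>i. x i - y i" "\<lambda>i. y i - z i" "{..<k}"] by simp
qed

lemma mspace_Rn_metric [simp]: "mspace (Rn_metric k) = topspace (Euclidean_space k)"
  by (simp add: Rn_metric_def Metric_space.mspace_metric[OF Metric_space_Euclidean])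

lemma mdist_Rn_metric [simp]:
  "mdist (Rn_metric k) = (\<lambda>x y. L2_set (\<lambda>i. x i - y i) {..<k})"
  by (simp add: Rn_metric_def Metric_space.mdist_metric[OF Metric_space_Euclidean])

definition k_rectifiable :: "nat \<Rightarrow> 'a::metric_space set \<Rightarrow> bool" where
  "k_rectifiable k E \<longleftrightarrow>
     (\<exists>S f. Metric_space.mbounded (mspace (Rn_metric k)) (mdist (Rn_metric k)) S \<and>
            Lipschitz_continuous_map (submetric (Rn_metric k) S) euclidean_metric f \<and>
            f ` S = E)"

definition countably_k_rectifiable :: "nat \<Rightarrow> 'a::metric_space set \<Rightarrow> bool" where
  "countably_k_rectifiable k E \<longleftrightarrow>
     (\<exists>\<C>. countable \<C> \<and> (\<forall>C\<in>\<C>. k_rectifiable k C) \<and> E = \<Union>\<C>)"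

text \<open>
  Measures are meant here in the sense of geometric measure theory, as outer measures defined on
  all subsets, so that \<open>\<mu> (E - F)\<close> makes sense for arbitrary \<open>E\<close> and \<open>F\<close>.
\<close>

definition countably_mu_rectifiable ::
    "('a::metric_space set \<Rightarrow> ennreal) \<Rightarrow> nat \<Rightarrow> 'a set \<Rightarrow> bool" where
  "countably_mu_rectifiable \<mu> k E \<longleftrightarrow>
     outer_measure_space (Pow E) \<mu> \<and>
     (\<exists>F. countably_k_rectifiable k F \<and> \<mu> (E - F) = 0)"

definition mu_rectifiable :: "('a::metric_space set \<Rightarrow> ennreal) \<Rightarrow> nat \<Rightarrow> 'a set \<Rightarrow> bool" where
  "mu_rectifiable \<mu> k E \<longleftrightarrow> countably_mu_rectifiable \<mu> k E \<and> \<mu> E < \<infinity>"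

end

theory Submission
  imports Defs
begin

text \<open>
  Write \<open>d\<close> for the dimension, \<open>k = d - 1\<close>, \<open>E\<close> for the boundary and \<open>v a = M a - a\<close>, so that the
  segment of \<open>a\<close> consists of the points \<open>a + t v a\<close> with \<open>0 \<le> t \<le> 1\<close>.  The two Hausdorff measures
  are compared with Lebesgue measure \<open>L\<close> from opposite sides: \<open>H\<^sup>d \<le> L\<close> on measurable sets
  (\<open>hausdorff_measure_le_lebesgue\<close>), and \<open>L\<close> of the union of the segments is estimated by
  \<open>k\<close>-dimensional covering sums of \<open>E\<close> (\<open>emeasure_tube_le_hausdorff_measure\<close>).

  For the second comparison let \<open>B\<close> be a small piece of \<open>E\<close>, of diameter \<open>r\<close>.  The segments that
  start in \<open>B\<close> form a tube.  The map \<open>a \<mapsto> a + t v a\<close> is a convex combination of two isometries and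
  hence never increases distances, and the directions \<open>v a\<close> of the segments differ by at most \<open>2 r\<close>
  within \<open>B\<close>.  So if the tube is cut into thin slabs orthogonal to one of the directions, the
  projection of each slab along that direction has diameter at most \<open>r (1 + O(r))\<close>, while the total
  height is at most \<open>w + O(r)\<close>.  An isodiametric inequality for the cross-sections bounds the volume
  of the tube by \<open>(w + O(r)) (1 + O(r))\<^sup>k c r\<^sup>k\<close> with \<open>c = \<omega>\<^sub>k / 2\<^sup>k\<close>
  (\<open>measure_fast_tube\<close>).  Since \<open>c r\<^sup>k\<close> is exactly what \<open>B\<close> contributes to a covering sum for
  \<open>H\<^sup>k E\<close>, summation over a fine cover and a limit give \<open>L \<le> w H\<^sup>k E\<close>.  The constants degenerate
  where \<open>v\<close> is small, but there the tube is so short that a crude estimate is enough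
  (\<open>measure_slow_tube\<close>).

  The isodiametric inequality comes in a form that avoids slicing: a compact set of height \<open>h\<close> along
  a unit vector, whose projection along this vector has diameter at most \<open>r\<close>, has volume at most
  \<open>h c r\<^sup>k\<close> (\<open>isodiametric_cylinder\<close>).  Indeed its difference set lies in a round cylinder of
  height \<open>2 h\<close> and radius \<open>r\<close>, and by the Brunn--Minkowski inequality for \<open>X\<close> and \<open>-X\<close> the difference
  set of \<open>X\<close> has at least \<open>2\<^sup>d\<close> times the volume of \<open>X\<close>.
\<close>

section \<open>The Brunn--Minkowski inequality in multiplicative form\<close>

text \<open>
  Nonempty interiors serve an induction over the number of boxes: a hyperplane that separates two
  boxes leaves only a degenerate piece of each of them on the wrong side, and as such pieces do not
  count as boxes, both sides have fewer boxes than before.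
\<close>

definition box_family :: "'a::euclidean_space set set \<Rightarrow> bool" where
  "box_family D \<longleftrightarrow>
     finite D \<and> (\<forall>K\<in>D. \<exists>a b. K = cbox a b \<and> box a b \<noteq> {}) \<and>
     pairwise (\<lambda>K L. interior K \<inter> interior L = {}) D"

lemma compact_Union_box_family: "box_family D \<Longrightarrow> compact (\<Union>D)"
  unfolding box_family_def by (intro compact_Union) auto

lemma measure_Union_box_family_pos:
  assumes "box_family D" "D \<noteq> {}"
  shows "0 < measure lebesgue (\<Union>D)"
proof -
  obtain K where K: "K \<in> D" using assms by auto
  then obtain a b where ab: "K = cbox a b" "box a b \<noteq> {}"
    using assms unfolding box_family_def by blast
  have "0 < measure lebesgue (cbox a b)"
    using ab(2) by (simp add: box_ne_empty content_cbox_if prod_pos less_imp_le box_eq_empty)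
      (auto intro!: prod_pos simp: box_eq_empty not_le)
  also have "\<dots> \<le> measure lebesgue (\<Union>D)"
    using K ab compact_Union_box_family[OF assms(1)]
    by (intro measure_mono_fmeasurable) (auto intro: lmeasurable_compact)
  finally show ?thesis .
qed

definition restrict_boxes :: "'a::euclidean_space set \<Rightarrow> 'a set set \<Rightarrow> 'a set set" where
  "restrict_boxes H D = (\<lambda>K. K \<inter> H) ` {K \<in> D. interior (K \<inter> H) \<noteq> {}}"

lemma cbox_cut:
  assumes i: "i \<in> Basis" and H: "H = {x. x \<bullet> i \<le> c} \<or> H = {x. x \<bullet> i \<ge> c}"
  shows "\<exists>a' b'. cbox a b \<inter> H = cbox a' b'"
  using H
proof
  assume "H = {x. x \<bullet> i \<le> c}"
  then show ?thesis by (simp only: interval_split(1)[OF i]) blast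
next
  assume "H = {x. x \<bullet> i \<ge> c}"
  then show ?thesis by (simp only: interval_split(2)[OF i]) blast
qed

lemma box_family_restrict_boxes:
  assumes D: "box_family D" and i: "i \<in> Basis"
    and H: "H = {x. x \<bullet> i \<le> c} \<or> H = {x. x \<bullet> i \<ge> c}"
  shows "box_family (restrict_boxes H D)"
  unfolding box_family_def
proof (intro conjI ballI)
  show "finite (restrict_boxes H D)"
    using D by (auto simp: restrict_boxes_def box_family_def)
  show "pairwise (\<lambda>K L. interior K \<inter> interior L = {}) (restrict_boxes H D)"
  proof (rule pairwiseI)
    fix K L assume "K \<in> restrict_boxes H D" "L \<in> restrict_boxes H D" "K \<noteq> L"
    then obtain K' L' where "K = K' \<inter> H" "L = L' \<inter> H" "K' \<in> D" "L' \<in> D" "K' \<noteq> L'"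
      unfolding restrict_boxes_def by blast
    moreover from this have "interior K' \<inter> interior L' = {}"
      using D by (simp add: box_family_def pairwise_def)
    ultimately show "interior K \<inter> interior L = {}"
      by auto
  qed
  fix L assume "L \<in> restrict_boxes H D"
  then obtain K where K: "K \<in> D" "L = K \<inter> H" "interior (K \<inter> H) \<noteq> {}"
    by (auto simp: restrict_boxes_def)
  obtain a b where "K = cbox a b" using D K unfolding box_family_def by blast
  then obtain a' b' where "L = cbox a' b'"
    using cbox_cut[OF i H] K(2) by blast
  then show "\<exists>a b. L = cbox a b \<and> box a b \<noteq> {}"
    using K(2,3) by (metis interior_cbox)
qed

lemma measure_restrict_boxes:
  assumes D: "box_family D" and i: "i \<in> Basis"
    and H: "H = {x. x \<bullet> i \<le> c} \<or> H = {x. x \<bullet> i \<ge> c}"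
  shows "measure lebesgue (\<Union>(restrict_boxes H D)) = measure lebesgue (\<Union>D \<inter> H)"
proof -
  have "negligible (\<Union>((\<lambda>K. K \<inter> H) ` {K \<in> D. interior (K \<inter> H) = {}}))"
  proof (rule negligible_Union)
    show "finite ((\<lambda>K. K \<inter> H) ` {K \<in> D. interior (K \<inter> H) = {}})"
      using D by (auto simp: box_family_def)
    fix L assume "L \<in> (\<lambda>K. K \<inter> H) ` {K \<in> D. interior (K \<inter> H) = {}}"
    then obtain K where K: "K \<in> D" "L = K \<inter> H" "interior (K \<inter> H) = {}"
      by auto
    obtain a b where "K = cbox a b" using D K unfolding box_family_def by blast
    then obtain a' b' where "L = cbox a' b'"
      using cbox_cut[OF i H] K(2) by blast
    then show "negligible L"
      using K(2,3) by (metis interior_cbox negligible_interval(1))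
  qed
  moreover have "\<Union>D \<inter> H - \<Union>(restrict_boxes H D)
      \<subseteq> \<Union>((\<lambda>K. K \<inter> H) ` {K \<in> D. interior (K \<inter> H) = {}})"
    by (auto simp: restrict_boxes_def)
  ultimately have "negligible (\<Union>D \<inter> H - \<Union>(restrict_boxes H D))"
    by (rule negligible_subset)
  moreover have "\<Union>(restrict_boxes H D) - \<Union>D \<inter> H = {}"
    by (auto simp: restrict_boxes_def)
  moreover have "closed H"
    using H by (auto simp: closed_halfspace_component_le closed_halfspace_component_ge)
  then have "\<Union>D \<inter> H \<in> lmeasurable"
    by (intro lmeasurable_compact compact_Int_closed compact_Union_box_family[OF D])
  ultimately show ?thesis
    by (intro measure_negligible_symdiff) auto
qed

lemma card_restrict_boxes_le:
  assumes "box_family D"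
  shows "card (restrict_boxes H D) \<le> card D"
proof -
  have "card (restrict_boxes H D) \<le> card {K \<in> D. interior (K \<inter> H) \<noteq> {}}"
    unfolding restrict_boxes_def using assms by (intro card_image_le) (simp add: box_family_def)
  also have "\<dots> \<le> card D"
    using assms by (intro card_mono) (auto simp: box_family_def)
  finally show ?thesis .
qed

lemma card_restrict_boxes_less:
  assumes "box_family D" "K \<in> D" "interior (K \<inter> H) = {}"
  shows "card (restrict_boxes H D) < card D"
proof -
  have "card (restrict_boxes H D) \<le> card {K \<in> D. interior (K \<inter> H) \<noteq> {}}"
    unfolding restrict_boxes_def using assms by (intro card_image_le) (simp add: box_family_def)
  also have "\<dots> < card D"
    using assms by (intro psubset_card_mono) (auto simp: box_family_def)
  finally show ?thesis .
qed

text \<open>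
  Of two boxes with disjoint interiors one lies on each side of some hyperplane parallel to the
  axes; which of the two is on the lower side is left open, whence the new names in the conclusion.
\<close>

lemma separating_coordinate:
  assumes D: "box_family D" and K: "K \<in> D" "L \<in> D" "K \<noteq> L"
  obtains i c K' L' where "i \<in> Basis" "K' \<in> D" "L' \<in> D"
    "K' \<subseteq> {x. x \<bullet> i \<le> c}" "L' \<subseteq> {x. x \<bullet> i \<ge> c}"
proof -
  obtain a b where ab: "K = cbox a b" "box a b \<noteq> {}"
    using D K unfolding box_family_def by blast
  obtain a' b' where ab': "L = cbox a' b'" "box a' b' \<noteq> {}"
    using D K unfolding box_family_def by blast
  have "interior K \<inter> interior L = {}"
    using D K by (simp add: box_family_def pairwise_def)
  then have "box a b \<inter> box a' b' = {}"
    by (simp add: ab ab')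
  then obtain i where i: "i \<in> Basis" "b\<bullet>i \<le> a\<bullet>i \<or> b'\<bullet>i \<le> a'\<bullet>i \<or> b\<bullet>i \<le> a'\<bullet>i \<or> b'\<bullet>i \<le> a\<bullet>i"
    unfolding disjoint_interval by blast
  then have "b\<bullet>i \<le> a'\<bullet>i \<or> b'\<bullet>i \<le> a\<bullet>i"
    using ab(2) ab'(2) by (auto simp: box_ne_empty)
  then show thesis
  proof
    assume "b\<bullet>i \<le> a'\<bullet>i"
    then show thesis
      using i(1) K by (intro that[of i K L "b \<bullet> i"]) (auto simp: ab ab' mem_box intro: order_trans)
  next
    assume "b'\<bullet>i \<le> a\<bullet>i"
    then show thesis
      using i(1) K by (intro that[of i L K "b' \<bullet> i"]) (auto simp: ab ab' mem_box intro: order_trans)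
  qed
qed

lemma interior_cut_empty:
  fixes L :: "'a::euclidean_space set"
  assumes "i \<in> Basis"
    "L \<subseteq> {x. x \<bullet> i \<ge> c} \<and> H = {x. x \<bullet> i \<le> c} \<or> L \<subseteq> {x. x \<bullet> i \<le> c} \<and> H = {x. x \<bullet> i \<ge> c}"
  shows "interior (L \<inter> H) = {}"
proof -
  have "L \<inter> H \<subseteq> {x. i \<bullet> x = c}"
    using assms(2) by (auto simp: inner_commute)
  then have "negligible (L \<inter> H)"
    using assms(1) by (intro negligible_subset[OF negligible_hyperplane[of i c]]) auto
  then have "negligible (interior (L \<inter> H))"
    by (rule negligible_subset) (rule interior_subset)
  then show ?thesis
    using open_not_negligible open_interior by blast
qed

text \<open>
  Dominated convergence applies because the indicator functions converge off the hyperplane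
  \<open>x \<bullet> i = c\<close>, which is a null set.  Continuity is what makes it possible to cut off a
  prescribed fraction of the volume.
\<close>

lemma continuous_measure_halfspace:
  fixes S :: "'a::euclidean_space set"
  assumes S: "compact S" and i: "i \<in> Basis"
  shows "continuous_on UNIV (\<lambda>c. measure lebesgue (S \<inter> {x. x \<bullet> i \<le> c}))"
  unfolding continuous_on_sequentially comp_def
proof (intro ballI allI impI, elim conjE)
  fix c :: real and f assume f: "f \<longlonglongrightarrow> c"
  have cl: "closed {x. x \<bullet> i \<le> c}" for c
    by (simp add: closed_halfspace_component_le)
  have m: "S \<inter> {x. x \<bullet> i \<le> c} \<in> lmeasurable" for c
    by (intro lmeasurable_compact compact_Int_closed S cl)
  have eq: "measure lebesgue (S \<inter> {x. x \<bullet> i \<le> c}) =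
      (\<integral>x. indicat_real (S \<inter> {x. x \<bullet> i \<le> c}) x \<partial>lebesgue)" for c
    by simp
  have "AE x in lebesgue. x \<notin> {x. i \<bullet> x = c}"
    using i by (intro AE_not_in, fold negligible_iff_null_sets, intro negligible_hyperplane) auto
  then have lim: "AE x in lebesgue. (\<lambda>n. indicat_real (S \<inter> {x. x \<bullet> i \<le> f n}) x)
      \<longlonglongrightarrow> indicat_real (S \<inter> {x. x \<bullet> i \<le> c}) x"
  proof eventually_elim
    case (elim x)
    then consider "x \<bullet> i < c" | "x \<bullet> i > c" by (force simp: inner_commute)
    then show ?case
    proof cases
      case 1
      then have "\<forall>\<^sub>F n in sequentially. x \<bullet> i < f n" using f order_tendstoD(1) by blast
      then have "\<forall>\<^sub>F n in sequentially. indicat_real (S \<inter> {x. x \<bullet> i \<le> f n}) x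
          = indicat_real (S \<inter> {x. x \<bullet> i \<le> c}) x"
        by eventually_elim (use 1 in \<open>auto simp: indicator_def\<close>)
      then show ?thesis by (simp add: tendsto_eventually)
    next
      case 2
      then have "\<forall>\<^sub>F n in sequentially. f n < x \<bullet> i" using f order_tendstoD(2) by blast
      then have "\<forall>\<^sub>F n in sequentially. indicat_real (S \<inter> {x. x \<bullet> i \<le> f n}) x
          = indicat_real (S \<inter> {x. x \<bullet> i \<le> c}) x"
        by eventually_elim (use 2 in \<open>auto simp: indicator_def\<close>)
      then show ?thesis by (simp add: tendsto_eventually)
    qed
  qed
  show "(\<lambda>n. measure lebesgue (S \<inter> {x. x \<bullet> i \<le> f n})) \<longlonglongrightarrow> measure lebesgue (S \<inter> {x. x \<bullet> i \<le> c})"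
    unfolding eq
  proof (rule integral_dominated_convergence[where w = "indicat_real S"])
    show "AE x in lebesgue. (\<lambda>n. indicat_real (S \<inter> {x. x \<bullet> i \<le> f n}) x)
      \<longlonglongrightarrow> indicat_real (S \<inter> {x. x \<bullet> i \<le> c}) x"
      by (fact lim)
    show "integrable lebesgue (indicat_real S)"
      using S lmeasurable_compact by (auto simp: lmeasurable_iff_integrable)
    show "indicat_real (S \<inter> {x. x \<bullet> i \<le> c}) \<in> borel_measurable lebesgue"
      "indicat_real (S \<inter> {x. x \<bullet> i \<le> f n}) \<in> borel_measurable lebesgue" for n
      by (intro borel_measurable_indicator fmeasurableD m)+
    show "AE x in lebesgue. norm (indicat_real (S \<inter> {x. x \<bullet> i \<le> f n}) x) \<le> indicat_real S x" for n
      by (auto simp: indicator_def)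
  qed
qed

lemma measure_halfspace_split:
  fixes S :: "'a::euclidean_space set"
  assumes S: "compact S" and i: "i \<in> Basis"
  shows "measure lebesgue S =
    measure lebesgue (S \<inter> {x. x \<bullet> i \<le> c}) + measure lebesgue (S \<inter> {x. x \<bullet> i \<ge> c})"
proof -
  have "negligible (S \<inter> {x. x \<bullet> i \<le> c} \<inter> (S \<inter> {x. x \<bullet> i \<ge> c}))"
    by (rule negligible_subset[OF negligible_hyperplane[of i c]]) (use i in \<open>auto simp: inner_commute\<close>)
  then have "measure lebesgue (S \<inter> {x. x \<bullet> i \<le> c} \<union> S \<inter> {x. x \<bullet> i \<ge> c}) =
    measure lebesgue (S \<inter> {x. x \<bullet> i \<le> c}) + measure lebesgue (S \<inter> {x. x \<bullet> i \<ge> c})"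
    by (subst measure_Un3) (auto intro!: lmeasurable_compact compact_Int_closed S 
        simp: closed_halfspace_component_le closed_halfspace_component_ge negligible_imp_measure0)
  moreover have "S \<inter> {x. x \<bullet> i \<le> c} \<union> S \<inter> {x. x \<bullet> i \<ge> c} = S"
    by auto
  ultimately show ?thesis by simp
qed

lemma halfspace_of_given_measure:
  fixes S :: "'a::euclidean_space set"
  assumes S: "compact S" and i: "i \<in> Basis" and m: "0 < m" "m < measure lebesgue S"
  obtains c where "measure lebesgue (S \<inter> {x. x \<bullet> i \<le> c}) = m"
proof -
  obtain r where r: "\<And>x. x \<in> S \<Longrightarrow> norm x \<le> r"
    using compact_imp_bounded[OF S] by (auto simp: bounded_iff)
  have *: "\<bar>x \<bullet> i\<bar> \<le> r" if "x \<in> S" for x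
    using Basis_le_norm[OF i, of x] r[OF that] by linarith
  have 1: "S \<inter> {x. x \<bullet> i \<le> - \<bar>r\<bar> - 1} = {}"
    by (auto dest!: *)
  have 2: "S \<inter> {x. x \<bullet> i \<le> \<bar>r\<bar> + 1} = S"
    by (auto dest: *)
  have "\<exists>c\<ge>- \<bar>r\<bar> - 1. c \<le> \<bar>r\<bar> + 1 \<and> measure lebesgue (S \<inter> {x. x \<bullet> i \<le> c}) = m"
  proof (rule IVT')
    show "continuous_on {- \<bar>r\<bar> - 1..\<bar>r\<bar> + 1} (\<lambda>c. measure lebesgue (S \<inter> {x. x \<bullet> i \<le> c}))"
      using continuous_measure_halfspace[OF S i] by (rule continuous_on_subset) simp
    show "measure lebesgue (S \<inter> {x. x \<bullet> i \<le> - \<bar>r\<bar> - 1}) \<le> m"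
      unfolding 1 using m by simp
    show "m \<le> measure lebesgue (S \<inter> {x. x \<bullet> i \<le> \<bar>r\<bar> + 1})"
      unfolding 2 using m by simp
  qed simp
  then show thesis using that by blast
qed

lemma prod_sqrt:
  fixes f :: "'a \<Rightarrow> real"
  shows "sqrt (\<Prod>i\<in>A. f i) = (\<Prod>i\<in>A. sqrt (f i))"
  by (induction A rule: infinite_finite_induct) (auto simp: real_sqrt_mult)

text \<open>
  The base case of the induction: side lengths of boxes add up, so the claim is the inequality of
  the arithmetic and the geometric mean in each coordinate.
\<close>

lemma box_sum_measure:
  fixes a b c d :: "'a::euclidean_space"
  assumes "box a b \<noteq> {}" "box c d \<noteq> {}"
  shows "2 ^ DIM('a) * sqrt (measure lebesgue (cbox a b) * measure lebesgue (cbox c d))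
      \<le> measure lebesgue (\<Union>x\<in>cbox a b. \<Union>y\<in>cbox c d. {x + y})"
proof -
  have ab: "\<And>i. i \<in> Basis \<Longrightarrow> a \<bullet> i < b \<bullet> i" and cd: "\<And>i. i \<in> Basis \<Longrightarrow> c \<bullet> i < d \<bullet> i"
    using assms by (auto simp: box_ne_empty)
  have ne: "cbox a b \<noteq> {}" "cbox c d \<noteq> {}"
    using assms box_subset_cbox by blast+
  have eq: "(\<Union>x\<in>cbox a b. \<Union>y\<in>cbox c d. {x + y}) \<supseteq> cbox (a + c) (b + d)"
  proof
    fix z assume z: "z \<in> cbox (a + c) (b + d)"
    \<comment> \<open>In each coordinate the summand from the first box is chosen as small as possible.\<close>
    define x where "x = (\<Sum>i\<in>Basis. max (a \<bullet> i) (z \<bullet> i - d \<bullet> i) *\<^sub>R i)"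
    have x: "x \<bullet> i = max (a \<bullet> i) (z \<bullet> i - d \<bullet> i)" if "i \<in> Basis" for i
      using that by (simp add: x_def)
    have "x \<in> cbox a b" "z - x \<in> cbox c d"
      using z ab cd by (auto simp: mem_box x inner_diff_left inner_add_left max_def less_imp_le
         algebra_simps dest!: bspec)
    then show "z \<in> (\<Union>x\<in>cbox a b. \<Union>y\<in>cbox c d. {x + y})"
      by (intro UN_I[of x] UN_I[of "z - x"]) auto
  qed
  have "2 ^ DIM('a) * sqrt (measure lebesgue (cbox a b) * measure lebesgue (cbox c d)) =
      (\<Prod>i\<in>(Basis::'a set). 2 * sqrt (((b - a) \<bullet> i) * ((d - c) \<bullet> i)))"
    using ne by (simp add: content_cbox' prod.distrib real_sqrt_mult prod_sqrt inner_diff_left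
        flip: prod_constant)
  also have "\<dots> \<le> (\<Prod>i\<in>(Basis::'a set). ((b + d) - (a + c)) \<bullet> i)"
  proof (rule prod_mono, intro conjI)
    fix i :: 'a assume i: "i \<in> Basis"
    have p: "0 < (b - a) \<bullet> i" "0 < (d - c) \<bullet> i"
      using ab[OF i] cd[OF i] by (simp_all add: inner_diff_left)
    then show "0 \<le> 2 * sqrt (((b - a) \<bullet> i) * ((d - c) \<bullet> i))" by simp
    show "2 * sqrt (((b - a) \<bullet> i) * ((d - c) \<bullet> i)) \<le> ((b + d) - (a + c)) \<bullet> i"
      using arith_geo_mean_sqrt[of "(b - a) \<bullet> i" "(d - c) \<bullet> i"] p
      by (simp add: inner_diff_left inner_add_left)
  qed
  also have "\<dots> = measure lebesgue (cbox (a + c) (b + d))"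
  proof -
    have "cbox (a + c) (b + d) \<noteq> {}"
      using ab cd by (auto simp: box_ne_empty inner_add_left less_imp_le add_mono)
    then show ?thesis
      by (simp add: content_cbox' inner_diff_left)
  qed
  also have "\<dots> \<le> measure lebesgue (\<Union>x\<in>cbox a b. \<Union>y\<in>cbox c d. {x + y})"
    using eq by (intro measure_mono_fmeasurable)
      (auto intro!: lmeasurable_compact compact_sums')
  finally show ?thesis .
qed

text \<open>
  The sums of the two lower parts and of the two upper parts lie on different sides of the hyperplane
  \<open>x \<bullet> i = c + c'\<close>, so their volumes may be added.
\<close>

lemma sums_split_measure:
  fixes A B :: "'a::euclidean_space set"
  assumes "compact A" "compact B" and i: "i \<in> Basis"
    and "A1 \<subseteq> A \<inter> {x. x \<bullet> i \<le> c}" "A2 \<subseteq> A \<inter> {x. x \<bullet> i \<ge> c}"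
    and "B1 \<subseteq> B \<inter> {x. x \<bullet> i \<le> c'}" "B2 \<subseteq> B \<inter> {x. x \<bullet> i \<ge> c'}"
    and "compact A1" "compact A2" "compact B1" "compact B2"
  shows "measure lebesgue (\<Union>x\<in>A1. \<Union>y\<in>B1. {x + y}) + measure lebesgue (\<Union>x\<in>A2. \<Union>y\<in>B2. {x + y})
    \<le> measure lebesgue (\<Union>x\<in>A. \<Union>y\<in>B. {x + y})"
proof -
  let ?S = "\<Union>x\<in>A. \<Union>y\<in>B. {x + y}"
  have S: "compact ?S"
    using assms by (intro compact_sums')
  have "(\<Union>x\<in>A1. \<Union>y\<in>B1. {x + y}) \<subseteq> ?S \<inter> {x. x \<bullet> i \<le> c + c'}"
  proof (intro UN_least)
    fix x y assume "x \<in> A1" "y \<in> B1"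
    then have "x \<in> A" "x \<bullet> i \<le> c" "y \<in> B" "y \<bullet> i \<le> c'"
      using assms(4,6) by auto
    then show "{x + y} \<subseteq> ?S \<inter> {x. x \<bullet> i \<le> c + c'}"
      by (auto simp: inner_add_left intro: add_mono)
  qed
  then have "measure lebesgue (\<Union>x\<in>A1. \<Union>y\<in>B1. {x + y}) \<le> measure lebesgue (?S \<inter> {x. x \<bullet> i \<le> c + c'})"
    by (intro measure_mono_fmeasurable lmeasurable_compact compact_Int_closed S
        fmeasurableD compact_sums' closed_halfspace_component_le assms)
  moreover have "(\<Union>x\<in>A2. \<Union>y\<in>B2. {x + y}) \<subseteq> ?S \<inter> {x. x \<bullet> i \<ge> c + c'}"
  proof (intro UN_least)
    fix x y assume "x \<in> A2" "y \<in> B2"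
    then have "x \<in> A" "x \<bullet> i \<ge> c" "y \<in> B" "y \<bullet> i \<ge> c'"
      using assms(5,7) by auto
    then show "{x + y} \<subseteq> ?S \<inter> {x. x \<bullet> i \<ge> c + c'}"
      by (auto simp: inner_add_left intro: add_mono)
  qed
  then have "measure lebesgue (\<Union>x\<in>A2. \<Union>y\<in>B2. {x + y}) \<le> measure lebesgue (?S \<inter> {x. x \<bullet> i \<ge> c + c'})"
    by (intro measure_mono_fmeasurable lmeasurable_compact compact_Int_closed S
        fmeasurableD compact_sums' closed_halfspace_component_ge assms)
  ultimately show ?thesis
    using measure_halfspace_split[OF S i, of "c + c'"] by linarith
qed

lemma sums_commute:
  fixes A B :: "'a::ab_semigroup_add set"
  shows "(\<Union>x\<in>A. \<Union>y\<in>B. {x + y}) = (\<Union>x\<in>B. \<Union>y\<in>A. {x + y})"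
  by (auto simp: add.commute) (metis add.commute)+

text \<open>
  The Hadwiger--Ohmann argument.  A hyperplane with a box of \<open>D\<close> on either side cuts \<open>D\<close> into two
  families with fewer boxes; a parallel hyperplane is chosen that divides \<open>E\<close> in the same ratio
  \<open>p : 1 - p\<close>.  Since the bound is homogeneous, the induction hypotheses for the lower and for the
  upper parts yield \<open>p\<close> and \<open>1 - p\<close> times the bound, and these add up.
\<close>

lemma Brunn_Minkowski_box_family:
  fixes D E :: "'a::euclidean_space set set"
  assumes "box_family D" "box_family E" "D \<noteq> {}" "E \<noteq> {}"
  shows "2 ^ DIM('a) * sqrt (measure lebesgue (\<Union>D) * measure lebesgue (\<Union>E))
    \<le> measure lebesgue (\<Union>x\<in>\<Union>D. \<Union>y\<in>\<Union>E. {x + y})"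
  using assms
proof (induction "card D + card E" arbitrary: D E rule: less_induct)
  case less
  let ?BM = "\<lambda>D E :: 'a set set. 2 ^ DIM('a) * sqrt (measure lebesgue (\<Union>D) * measure lebesgue (\<Union>E))
    \<le> measure lebesgue (\<Union>x\<in>\<Union>D. \<Union>y\<in>\<Union>E. {x + y})"
  have cut: "?BM D E"
    if D: "box_family D" "D \<noteq> {}" and E: "box_family E" "E \<noteq> {}" and "\<not> is_singleton D"
      and IH: "\<And>D' E'. card D' + card E' < card D + card E \<Longrightarrow> box_family D' \<Longrightarrow> box_family E' \<Longrightarrow>
            D' \<noteq> {} \<Longrightarrow> E' \<noteq> {} \<Longrightarrow> ?BM D' E'"
    for D E :: "'a set set"
  proof -
    have "\<exists>K'\<in>D. \<exists>L'\<in>D. K' \<noteq> L'"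
      using is_singletonI'[OF D(2)] \<open>\<not> is_singleton D\<close> by blast
    then obtain K' L' where "K' \<in> D" "L' \<in> D" "K' \<noteq> L'"
      by blast
    then obtain i c K L where i: "i \<in> Basis" and KL: "K \<in> D" "L \<in> D"
      and K: "K \<subseteq> {x. x \<bullet> i \<le> c}" and L: "L \<subseteq> {x. x \<bullet> i \<ge> c}"
      using separating_coordinate D(1) by metis
    define H1 where "H1 c = {x::'a. x \<bullet> i \<le> c}" for c
    define H2 where "H2 c = {x::'a. x \<bullet> i \<ge> c}" for c
    define \<mu> where "\<mu> D = measure lebesgue (\<Union>D)" for D :: "'a set set"
    have split: "box_family (restrict_boxes (H1 c) F)" "box_family (restrict_boxes (H2 c) F)"
        "\<mu> F = \<mu> (restrict_boxes (H1 c) F) + \<mu> (restrict_boxes (H2 c) F)" 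
      if "box_family F" for F c
      using that box_family_restrict_boxes[OF that i, of "H1 c" c] box_family_restrict_boxes[OF that i, of "H2 c" c]
        measure_restrict_boxes[OF that i, of "H1 c" c] measure_restrict_boxes[OF that i, of "H2 c" c]
        measure_halfspace_split[OF compact_Union_box_family[OF that] i, of c]
      by (auto simp: H1_def H2_def \<mu>_def)
    have ne: "interior J \<noteq> {}" if "J \<in> D" for J
      using D(1) that unfolding box_family_def by (metis interior_cbox)
    have "K \<in> restrict_boxes (H1 c) D" "L \<in> restrict_boxes (H2 c) D"
      using KL K L ne unfolding restrict_boxes_def H1_def H2_def
      by (metis (mono_tags, lifting) Int_absorb2 image_eqI mem_Collect_eq)+
    then have ne: "restrict_boxes (H1 c) D \<noteq> {}" "restrict_boxes (H2 c) D \<noteq> {}"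
      by auto
    have card: "card (restrict_boxes (H1 c) D) < card D" "card (restrict_boxes (H2 c) D) < card D"
      using card_restrict_boxes_less[OF D(1) KL(2), of "H1 c"] interior_cut_empty[OF i, of L c "H1 c"] L
        card_restrict_boxes_less[OF D(1) KL(1), of "H2 c"] interior_cut_empty[OF i, of K c "H2 c"] K
      unfolding H1_def H2_def by auto
    define p where "p = \<mu> (restrict_boxes (H1 c) D) / \<mu> D"
    have pos: "0 < \<mu> (restrict_boxes (H1 c) D)" "0 < \<mu> (restrict_boxes (H2 c) D)" "0 < \<mu> D" "0 < \<mu> E"
      using measure_Union_box_family_pos split(1,2)[OF D(1)] D E ne by (auto simp: \<mu>_def)
    have p: "0 < p" "p < 1"
      using pos split(3)[OF D(1), of c] by (auto simp: p_def field_simps)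
    have D12: "\<mu> (restrict_boxes (H1 c) D) = p * \<mu> D" "\<mu> (restrict_boxes (H2 c) D) = (1 - p) * \<mu> D"
      using pos split(3)[OF D(1), of c] by (auto simp: p_def field_simps)
    have "0 < p * \<mu> E" "p * \<mu> E < measure lebesgue (\<Union>E)"
      using p pos by (auto simp: \<mu>_def)
    then obtain c' where "measure lebesgue (\<Union>E \<inter> {x. x \<bullet> i \<le> c'}) = p * \<mu> E"
      using halfspace_of_given_measure[OF compact_Union_box_family[OF E(1)] i] by blast
    then have E1: "\<mu> (restrict_boxes (H1 c') E) = p * \<mu> E"
      using measure_restrict_boxes[OF E(1) i, of "H1 c'" c'] by (simp add: \<mu>_def H1_def)
    have E2: "\<mu> (restrict_boxes (H2 c') E) = (1 - p) * \<mu> E"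
      using E1 split(3)[OF E(1), of c'] by (simp add: algebra_simps)
    have neE: "restrict_boxes (H1 c') E \<noteq> {}" "restrict_boxes (H2 c') E \<noteq> {}"
      using E1 E2 p pos by (auto simp: \<mu>_def)
    have "sqrt ((q * \<mu> D) * (q * \<mu> E)) = q * sqrt (\<mu> D * \<mu> E)" if "q \<ge> 0" for q
      using that by (simp add: real_sqrt_mult)
    then have eq: "sqrt (\<mu> (restrict_boxes (H1 c) D) * \<mu> (restrict_boxes (H1 c') E)) = p * sqrt (\<mu> D * \<mu> E)"
      "sqrt (\<mu> (restrict_boxes (H2 c) D) * \<mu> (restrict_boxes (H2 c') E)) = (1 - p) * sqrt (\<mu> D * \<mu> E)"
      unfolding D12 E1 E2 using p by simp_all
    have "2 ^ DIM('a) * sqrt (\<mu> D * \<mu> E) =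
        2 ^ DIM('a) * sqrt (\<mu> (restrict_boxes (H1 c) D) * \<mu> (restrict_boxes (H1 c') E)) +
        2 ^ DIM('a) * sqrt (\<mu> (restrict_boxes (H2 c) D) * \<mu> (restrict_boxes (H2 c') E))"
      unfolding eq by (simp add: algebra_simps)
    also have "\<dots> \<le>
        measure lebesgue (\<Union>x\<in>\<Union>(restrict_boxes (H1 c) D). \<Union>y\<in>\<Union>(restrict_boxes (H1 c') E). {x + y}) +
        measure lebesgue (\<Union>x\<in>\<Union>(restrict_boxes (H2 c) D). \<Union>y\<in>\<Union>(restrict_boxes (H2 c') E). {x + y})"
      unfolding \<mu>_def
    proof (rule add_mono)
      show "?BM (restrict_boxes (H1 c) D) (restrict_boxes (H1 c') E)"
        by (rule IH) (use card card_restrict_boxes_le[OF E(1), of "H1 c'"] split D E ne neE in auto)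
      show "?BM (restrict_boxes (H2 c) D) (restrict_boxes (H2 c') E)"
        by (rule IH) (use card card_restrict_boxes_le[OF E(1), of "H2 c'"] split D E ne neE in auto)
    qed
    also have "\<dots> \<le> measure lebesgue (\<Union>x\<in>\<Union>D. \<Union>y\<in>\<Union>E. {x + y})"
      by (intro sums_split_measure[OF _ _ i, where c = c and c' = c'] compact_Union_box_family split D E)
        (auto simp: restrict_boxes_def H1_def H2_def)
    finally show ?thesis
      unfolding \<mu>_def .
  qed
  show ?case
  proof (cases "is_singleton D")
    case False
    show ?thesis
      by (rule cut[OF less.prems(1,3,2,4) False]) (rule less.hyps)
  next
    case singD: True
    show ?thesis
    proof (cases "is_singleton E")
      case False
      have "?BM E D"
        by (rule cut[OF less.prems(2,4,1,3) False]) (rule less.hyps, simp add: add.commute)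
      then show ?thesis
        by (subst sums_commute) (simp only: mult.commute[of "measure lebesgue (\<Union>D)"])
    next
      case True
      obtain K L where KL: "D = {K}" "E = {L}"
        using True singD by (auto simp: is_singleton_def)
      have "\<exists>a b. K = cbox a b \<and> box a b \<noteq> {}" "\<exists>a b. L = cbox a b \<and> box a b \<noteq> {}"
        using less.prems(1,2) by (simp_all add: box_family_def KL)
      then obtain a b c d where "K = cbox a b" "box a b \<noteq> {}" "L = cbox c d" "box c d \<noteq> {}"
        by (elim exE conjE)
      then show ?thesis
        using box_sum_measure[of a b c d] by (simp add: KL)
    qed
  qed
qed

text \<open>
  The boxes come from a division of a large box into pieces finer than \<open>e\<close>; degenerate pieces form a
  null set and can be dropped.
\<close>

lemma compact_box_family_approx:
  fixes X :: "'a::euclidean_space set"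
  assumes X: "compact X" and e: "e > 0"
  obtains D where "box_family D" "measure lebesgue X \<le> measure lebesgue (\<Union>D)"
    "\<Union>D \<subseteq> (\<Union>x\<in>X. ball x e)"
proof -
  obtain a where a: "X \<subseteq> cbox (- a) a"
    using bounded_subset_cbox_symmetric[OF compact_imp_bounded[OF X]] by blast
  have "gauge (\<lambda>x::'a. ball x (e / 2))"
    using e by (simp add: gauge_def)
  then obtain p where p: "p tagged_division_of cbox (- a) a" "(\<lambda>x. ball x (e / 2)) fine p"
    using fine_division_exists by blast
  have q: "snd ` p division_of cbox (- a) a"
    using p(1) by (rule division_of_tagged_division)
  have near: "dist y z < e" if "K \<in> snd ` p" "y \<in> K" "z \<in> K" for K y z
  proof -
    obtain x where "K \<subseteq> ball x (e / 2)"
      using p(2) \<open>K \<in> snd ` p\<close> by (auto simp: fine_def)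
    then have "dist x y < e / 2" "dist x z < e / 2"
      using that by auto
    then show ?thesis
      using dist_triangle_half_r by blast
  qed
  define D where "D = {K \<in> snd ` p. K \<inter> X \<noteq> {} \<and> interior K \<noteq> {}}"
  show thesis
  proof
    show D: "box_family D"
      unfolding box_family_def
    proof (intro conjI ballI)
      show "finite D"
        using division_of_finite[OF q] by (simp add: D_def)
      show "\<exists>a b. K = cbox a b \<and> box a b \<noteq> {}" if "K \<in> D" for K
        using division_ofD(4)[OF q, of K] that by (auto simp: D_def)
      show "pairwise (\<lambda>K L. interior K \<inter> interior L = {}) D"
        using division_ofD(5)[OF q] by (auto simp: D_def pairwise_def)
    qed
    show "\<Union>D \<subseteq> (\<Union>x\<in>X. ball x e)"
    proof
      fix z assume "z \<in> \<Union>D"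
      then obtain K x where "K \<in> snd ` p" "z \<in> K" "x \<in> K" "x \<in> X"
        by (auto simp: D_def)
      with near[of K x z] show "z \<in> (\<Union>x\<in>X. ball x e)"
        by auto
    qed
    have "negligible (\<Union>{K \<in> snd ` p. interior K = {}})"
    proof (rule negligible_Union)
      show "finite {K \<in> snd ` p. interior K = {}}"
        using division_of_finite[OF q] by simp
      show "negligible K" if "K \<in> {K \<in> snd ` p. interior K = {}}" for K
        using division_ofD(4)[OF q, of K] that by (auto simp: negligible_interval)
    qed
    then have N: "\<Union>{K \<in> snd ` p. interior K = {}} \<in> null_sets lebesgue" (is "?N \<in> _")
      by (simp add: negligible_iff_null_sets)
    have D': "\<Union>D \<in> lmeasurable"
      by (intro lmeasurable_compact compact_Union_box_family D)
    have "X \<subseteq> \<Union>D \<union> ?N"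
    proof
      fix x assume "x \<in> X"
      then obtain K where "K \<in> snd ` p" "x \<in> K"
        using a division_ofD(6)[OF q] by blast
      with \<open>x \<in> X\<close> show "x \<in> \<Union>D \<union> ?N"
        unfolding D_def by blast
    qed
    then have "measure lebesgue X \<le> measure lebesgue (\<Union>D \<union> ?N)"
      using X D' N negligible_imp_measurable
      by (intro measure_mono_fmeasurable fmeasurable.Un)
        (auto simp: lmeasurable_compact fmeasurableD negligible_iff_null_sets)
    also have "\<dots> = measure lebesgue (\<Union>D)"
      using D' N by (intro measure_Un_null_set) (auto simp: fmeasurableD)
    finally show "measure lebesgue X \<le> measure lebesgue (\<Union>D)" .
  qed
qed

lemma box_family_uminus:
  fixes D :: "'a::euclidean_space set set"
  assumes "box_family D"
  shows "box_family ((`) uminus ` D)"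
  unfolding box_family_def
proof (intro conjI ballI)
  show "finite ((`) uminus ` D)"
    using assms by (simp add: box_family_def)
  show "\<exists>a b. L = cbox a b \<and> box a b \<noteq> {}" if L: "L \<in> (`) uminus ` D" for L
  proof -
    obtain K where K': "K \<in> D" "L = uminus ` K"
      using L by auto
    then obtain a b where K: "K = cbox a b" "box a b \<noteq> {}"
      using assms unfolding box_family_def by blast
    have "L = cbox (- b) (- a)"
      using image_smult_cbox[of "-1" a b] K box_subset_cbox[of a b] unfolding K'(2) by auto
    moreover have "box (- b) (- a) \<noteq> {}"
      using K by (simp add: box_ne_empty)
    ultimately show ?thesis by blast
  qed
  have int: "interior (uminus ` K) = uminus ` interior K" for K :: "'a set"
    by (rule interior_negations)
  show "pairwise (\<lambda>K L. interior K \<inter> interior L = {}) ((`) uminus ` D)"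
  proof (rule pairwiseI)
    fix K' L' assume *: "K' \<in> (`) uminus ` D" "L' \<in> (`) uminus ` D" "K' \<noteq> L'"
    then obtain K L where KL: "K \<in> D" "L \<in> D" "K' = uminus ` K" "L' = uminus ` L"
      by auto
    then have "K \<noteq> L"
      using * by blast
    then have "interior K \<inter> interior L = {}"
      using assms KL(1,2) by (auto simp: box_family_def pairwise_def)
    then show "interior K' \<inter> interior L' = {}"
      unfolding KL int by auto
  qed
qed

text \<open>
  Brunn--Minkowski for \<open>X\<close> and \<open>-X\<close>, which have the same volume.  If a union \<open>U\<close> of boxes is close
  to \<open>X\<close>, then \<open>U - U\<close> stays inside a given neighbourhood of \<open>X - X\<close>, so the inequality
  passes from finite unions of boxes to compact sets by outer regularity.
\<close>

lemma measure_difference_set_ge: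
  fixes X :: "'a::euclidean_space set"
  assumes X: "compact X"
  shows "2 ^ DIM('a) * measure lebesgue X \<le> measure lebesgue {x - y | x y. x \<in> X \<and> y \<in> X}"
proof (cases "X = {}")
  case False
  let ?Y = "{x - y | x y. x \<in> X \<and> y \<in> X}"
  have Y: "compact ?Y"
    using X by (intro compact_differences)
  show ?thesis
  proof (rule field_le_epsilon)
    fix \<epsilon> :: real assume "\<epsilon> > 0"
    then obtain U where U: "open U" "?Y \<subseteq> U" "U \<in> lmeasurable" "measure lebesgue U < measure lebesgue ?Y + \<epsilon>"
    proof -
      obtain U where U: "open U" "?Y \<subseteq> U" "U - ?Y \<in> lmeasurable" "emeasure lebesgue (U - ?Y) < ennreal \<epsilon>"
        by (rule sets_lebesgue_outer_open[OF fmeasurableD[OF lmeasurable_compact[OF Y]] \<open>\<epsilon> > 0\<close>])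
      have eq: "U = ?Y \<union> (U - ?Y)" using U(2) by blast
      have "U \<in> lmeasurable"
        using U(3) lmeasurable_compact[OF Y] by (subst eq) (rule fmeasurable.Un)
      moreover have "measure lebesgue U \<le> measure lebesgue ?Y + measure lebesgue (U - ?Y)"
        using U(3) lmeasurable_compact[OF Y] by (subst eq) (intro measure_Un_le fmeasurableD)
      moreover have "measure lebesgue (U - ?Y) < \<epsilon>"
        using U(3,4) \<open>\<epsilon> > 0\<close> by (simp add: emeasure_eq_measure2 ennreal_less_iff)
      ultimately show thesis
        using U that by force
    qed
    obtain e where e: "e > 0" "(\<Union>x\<in>?Y. ball x e) \<subseteq> U"
      using compact_subset_open_imp_ball_epsilon_subset[OF Y U(1,2)] by blast
    obtain D where D: "box_family D" "measure lebesgue X \<le> measure lebesgue (\<Union>D)"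
      "\<Union>D \<subseteq> (\<Union>x\<in>X. ball x (e / 2))"
      using compact_box_family_approx[OF X, of "e / 2"] e by auto
    let ?E = "(`) uminus ` D"
    have UE: "\<Union>?E = uminus ` \<Union>D"
      by auto
    show "2 ^ DIM('a) * measure lebesgue X \<le> measure lebesgue ?Y + \<epsilon>"
    proof (cases "D = {}")
      case True
      then have "measure lebesgue X = 0"
        using D(2) by (simp add: measure_le_0_iff)
      then show ?thesis
        using \<open>\<epsilon> > 0\<close> by (simp add: add_nonneg_nonneg)
    next
      case False
      have mE: "measure lebesgue (\<Union>?E) = measure lebesgue (\<Union>D)"
        unfolding UE using measure_lebesgue_affine[of "-1" 0 "\<Union>D"]
        by simp
      have "2 ^ DIM('a) * measure lebesgue X \<le> 2 ^ DIM('a) * sqrt (measure lebesgue (\<Union>D) * measure lebesgue (\<Union>?E))"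
        using D(2) by (simp add: mE)
      also have "\<dots> \<le> measure lebesgue (\<Union>x\<in>\<Union>D. \<Union>y\<in>\<Union>?E. {x + y})"
        using False by (intro Brunn_Minkowski_box_family box_family_uminus D) auto
      also have "\<dots> \<le> measure lebesgue U"
      proof (intro measure_mono_fmeasurable U)
        have near: "\<exists>x\<in>X. dist x z < e / 2" if "z \<in> \<Union>D" for z
          using subsetD[OF D(3) that] by simp
        show "(\<Union>x\<in>\<Union>D. \<Union>y\<in>\<Union>?E. {x + y}) \<subseteq> U"
        proof clarify
          fix x y K L assume "x \<in> K" "K \<in> D" "y \<in> L" "L \<in> D"
          then have "x \<in> \<Union>D" "y \<in> \<Union>D"
            by auto
          then obtain x' y' where "x' \<in> X" "y' \<in> X" "dist x' x < e / 2" "dist y' y < e / 2"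
            using near by metis
          then have "x - y \<in> ball (x' - y') e"
            using norm_triangle_ineq4[of "x' - x" "y' - y"] by (simp add: dist_norm algebra_simps)
          then show "x + - y \<in> U"
            using subsetD[OF e(2), of "x - y"] \<open>x' \<in> X\<close> \<open>y' \<in> X\<close> by auto
        qed
        show "(\<Union>x\<in>\<Union>D. \<Union>y\<in>\<Union>?E. {x + y}) \<in> sets lebesgue"
          by (intro fmeasurableD lmeasurable_compact compact_sums' compact_Union_box_family box_family_uminus D)
      qed
      finally show ?thesis
        using U(4) by simp
    qed
  qed
qed auto

section \<open>An isodiametric inequality for cylinders\<close>

lemma emeasure_axis_cylinder:
  fixes b :: "'a::euclidean_space"
  assumes b: "b \<in> Basis" and h: "0 \<le> h" and r: "0 < r"
  shows "emeasure lborel {x::'a. \<bar>x \<bullet> b\<bar> \<le> h \<and> (\<Sum>i\<in>Basis - {b}. (x \<bullet> i)\<^sup>2) \<le> r\<^sup>2}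
    = ennreal (2 * h * (unit_ball_vol (real (DIM('a) - 1)) * r ^ (DIM('a) - 1)))"
    (is "emeasure _ ?C = _")
proof -
  interpret product_sigma_finite "\<lambda>_::'a. lborel :: real measure"
    by standard
  let ?A = "Basis - {b} :: 'a set"
  let ?P = "\<lambda>I::'a set. Pi\<^sub>M I (\<lambda>_. lborel :: real measure)"
  let ?B = "{f. sqrt (\<Sum>i\<in>?A. (f i)\<^sup>2) \<le> r} \<inter> space (?P ?A)"
  have ins: "insert b ?A = Basis" and fin: "finite ?A" "b \<notin> ?A"
    using b by auto
  have C: "?C \<in> sets borel"
    by measurable
  have vm: "(\<lambda>f. \<Sum>b\<in>Basis. f b *\<^sub>R b) -` ?C \<inter> space (?P Basis) \<in> sets (?P Basis)"
    using C by measurable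
  \<comment> \<open>Lebesgue measure is the image of a product measure over the basis; the coordinate along the
    axis splits off, and the other coordinates form a ball of one dimension less.\<close>
  have "emeasure lborel ?C = emeasure (?P Basis) ((\<lambda>f. \<Sum>b\<in>Basis. f b *\<^sub>R b) -` ?C \<inter> space (?P Basis))"
    using C by (subst lborel_eq) (simp add: emeasure_distr)
  also have "\<dots> = (\<integral>\<^sup>+ f. indicator ((\<lambda>f. \<Sum>b\<in>Basis. f b *\<^sub>R b) -` ?C \<inter> space (?P Basis)) f \<partial>?P Basis)"
    by (rule nn_integral_indicator[OF vm, symmetric])
  also have "\<dots> = (\<integral>\<^sup>+ y. \<integral>\<^sup>+ f. indicator ((\<lambda>f. \<Sum>b\<in>Basis. f b *\<^sub>R b) -` ?C \<inter> space (?P Basis)) (f(b := y)) \<partial>?P ?A \<partial>lborel)"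
    by (rule product_nn_integral_insert_rev[OF fin, unfolded ins, OF borel_measurable_indicator[OF vm]])
  also have "\<dots> = (\<integral>\<^sup>+ y. \<integral>\<^sup>+ f. indicator {-h..h} y * indicator ?B f \<partial>?P ?A \<partial>lborel)"
  proof (intro nn_integral_cong)
    fix y f assume f: "f \<in> space (?P ?A)"
    have "f(b := y) \<in> space (?P Basis)"
      using f b by (auto simp: space_PiM PiE_def extensional_def)
    moreover have "(\<Sum>i\<in>Basis. (f(b := y)) i *\<^sub>R i) \<bullet> b = y"
      using b by simp
    moreover have "(\<Sum>i\<in>?A. ((\<Sum>i\<in>Basis. (f(b := y)) i *\<^sub>R i) \<bullet> i)\<^sup>2) = (\<Sum>i\<in>?A. (f i)\<^sup>2)"
      by (intro sum.cong) auto
    moreover have "sqrt (\<Sum>i\<in>?A. (f i)\<^sup>2) \<le> r \<longleftrightarrow> (\<Sum>i\<in>?A. (f i)\<^sup>2) \<le> r\<^sup>2"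
      using r by (simp add: real_sqrt_le_iff' sum_nonneg)
    ultimately show "indicator ((\<lambda>f. \<Sum>b\<in>Basis. f b *\<^sub>R b) -` ?C \<inter> space (?P Basis)) (f(b := y))
        = (indicator {-h..h} y * indicator ?B f :: ennreal)"
      using f by (auto simp: indicator_def simp del: inner_sum_left_Basis)
  qed
  also have "\<dots> = emeasure (?P ?A) ?B * emeasure lborel {-h..h}"
    by (simp add: nn_integral_cmult nn_integral_multc mult.commute)
  also have "emeasure (?P ?A) ?B = ennreal (unit_ball_vol (real (card ?A)) * r ^ card ?A)"
    using emeasure_cball_aux[OF fin(1) r] .
  also have "emeasure lborel {-h..h} = ennreal (2 * h)"
    using h by simp
  also have "card ?A = DIM('a) - 1"
    using b by simp
  also have "ennreal (unit_ball_vol (real (DIM('a) - 1)) * r ^ (DIM('a) - 1)) * ennreal (2 * h) =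
      ennreal (2 * h * (unit_ball_vol (real (DIM('a) - 1)) * r ^ (DIM('a) - 1)))"
    using h r by (simp add: mult.commute flip: ennreal_mult)
  finally show ?thesis .
qed

lemma norm_remove_component_sq:
  fixes u x :: "'a::real_inner"
  assumes "norm u = 1"
  shows "(norm (x - (x \<bullet> u) *\<^sub>R u))\<^sup>2 = (norm x)\<^sup>2 - (x \<bullet> u)\<^sup>2"
proof -
  have "u \<bullet> u = 1"
    using assms by (simp add: dot_square_norm)
  then show ?thesis
    unfolding power2_norm_eq_inner
    by (simp add: inner_diff_left inner_diff_right inner_commute power2_eq_square)
qed

text \<open>
  The uniqueness argument for Haar measure.  For nonnegative \<open>\<phi>\<close> and \<open>\<gamma>\<close>, Fubini's theorem and the
  invariance of Lebesgue measure under translations and reflections give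
  \<open>\<integral>\<phi>(f z) dz \<cdot> \<integral>\<gamma> = \<integral>\<gamma>(f z) dz \<cdot> \<integral>\<phi>\<close>.  For \<open>\<gamma>\<close> take the indicator function of the unit ball,
  which \<open>f\<close> preserves, and cancel.
\<close>

lemma emeasure_orthogonal_vimage:
  fixes f :: "'a::euclidean_space \<Rightarrow> 'a"
  assumes f: "orthogonal_transformation f" and C: "C \<in> sets borel"
  shows "emeasure lborel (f -` C) = emeasure lborel C"
proof -
  have lin: "linear f" and inj: "surj f"
    using f orthogonal_transformation_surj by (auto simp: orthogonal_transformation_def)
  have meas[measurable]: "f \<in> borel_measurable borel"
    using lin by (intro borel_measurable_continuous_onI linear_continuous_on linear_conv_bounded_linear[THEN iffD1])
  have shift: "(\<integral>\<^sup>+z. h (z + c) \<partial>lborel) = (\<integral>\<^sup>+z. h z \<partial>lborel)"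
    if [measurable]: "h \<in> borel_measurable borel" for h :: "'a \<Rightarrow> ennreal" and c
    using nn_integral_distr[of "(+) c" lborel borel h] by (simp add: lborel_distr_plus add.commute)
  have reflect: "(\<integral>\<^sup>+z. h (c - z) \<partial>lborel) = (\<integral>\<^sup>+z. h z \<partial>lborel)"
    if [measurable]: "h \<in> borel_measurable borel" for h :: "'a \<Rightarrow> ennreal" and c
  proof -
    have "distr lborel borel (\<lambda>x. c - x) = lborel"
      using lborel_affine[of "- 1" c] by (simp add: density_1)
    then show ?thesis
      using nn_integral_distr[of "\<lambda>x. c - x" lborel borel h] by simp
  qed
  have swap: "(\<integral>\<^sup>+z. \<phi> (f z) \<partial>lborel) * (\<integral>\<^sup>+y. \<gamma> y \<partial>lborel) =
      (\<integral>\<^sup>+z. \<gamma> (f z) \<partial>lborel) * (\<integral>\<^sup>+y. \<phi> y \<partial>lborel)"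
    if [measurable]: "\<phi> \<in> borel_measurable borel" "\<gamma> \<in> borel_measurable borel" for \<phi> \<gamma> :: "'a \<Rightarrow> ennreal"
  proof -
    have "(\<integral>\<^sup>+z. \<phi> (f z) \<partial>lborel) * (\<integral>\<^sup>+y. \<gamma> y \<partial>lborel) = (\<integral>\<^sup>+z. \<phi> (f z) * (\<integral>\<^sup>+y. \<gamma> (y + f z) \<partial>lborel) \<partial>lborel)"
      by (simp add: shift nn_integral_multc)
    also have "\<dots> = (\<integral>\<^sup>+z. (\<integral>\<^sup>+y. \<phi> (f z) * \<gamma> (y + f z) \<partial>lborel) \<partial>lborel)"
      by (simp add: nn_integral_cmult)
    also have "\<dots> = (\<integral>\<^sup>+y. (\<integral>\<^sup>+z. \<phi> (f z) * \<gamma> (y + f z) \<partial>lborel) \<partial>lborel)"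
      by (rule lborel_pair.Fubini') simp
    also have "\<dots> = (\<integral>\<^sup>+y. (\<integral>\<^sup>+z. \<phi> (f z - y) * \<gamma> (f z) \<partial>lborel) \<partial>lborel)"
    proof (rule nn_integral_cong)
      fix y
      obtain c where c: "y = f c"
        using inj by (metis surjD)
      show "(\<integral>\<^sup>+z. \<phi> (f z) * \<gamma> (y + f z) \<partial>lborel) = (\<integral>\<^sup>+z. \<phi> (f z - y) * \<gamma> (f z) \<partial>lborel)"
        using shift[of "\<lambda>z. \<phi> (f z - y) * \<gamma> (f z)" c] by (simp add: c linear_add[OF lin] add.commute)
    qed
    also have "\<dots> = (\<integral>\<^sup>+z. (\<integral>\<^sup>+y. \<phi> (f z - y) * \<gamma> (f z) \<partial>lborel) \<partial>lborel)"
      by (rule lborel_pair.Fubini') simp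
    also have "\<dots> = (\<integral>\<^sup>+z. (\<integral>\<^sup>+y. \<phi> y \<partial>lborel) * \<gamma> (f z) \<partial>lborel)"
      by (simp add: nn_integral_multc reflect)
    also have "\<dots> = (\<integral>\<^sup>+z. \<gamma> (f z) \<partial>lborel) * (\<integral>\<^sup>+y. \<phi> y \<partial>lborel)"
      by (simp add: nn_integral_cmult mult.commute)
    finally show ?thesis .
  qed
  let ?B = "ball 0 1 :: 'a set"
  have "(\<integral>\<^sup>+z. indicator C (f z) \<partial>lborel) * (\<integral>\<^sup>+y. indicator ?B y \<partial>lborel) =
      (\<integral>\<^sup>+z. indicator ?B (f z) \<partial>lborel) * (\<integral>\<^sup>+y. indicator C y \<partial>lborel)"
    using C by (intro swap borel_measurable_indicator) auto
  also have "(\<integral>\<^sup>+z. indicator ?B (f z) \<partial>lborel) = (\<integral>\<^sup>+z. indicator ?B z \<partial>lborel)"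
    by (intro nn_integral_cong) (simp add: indicator_def orthogonal_transformation_norm[OF f])
  also have "(\<integral>\<^sup>+z. indicator C (f z) \<partial>lborel) = (\<integral>\<^sup>+z. indicator (f -` C) z \<partial>lborel)"
    by (intro nn_integral_cong) (simp add: indicator_def)
  finally have "emeasure lborel (f -` C) * emeasure lborel ?B = emeasure lborel ?B * emeasure lborel C"
    using C measurable_sets[OF meas C] by simp
  moreover have "emeasure lborel ?B \<noteq> 0" "emeasure lborel ?B \<noteq> \<infinity>"
    using unit_ball_vol_pos[of "real DIM('a)"] by (simp_all add: emeasure_ball del: unit_ball_vol_pos)
  ultimately show ?thesis
    by (auto simp: mult.commute[of _ "emeasure lborel ?B"] ennreal_mult_cancel_left)
qed

lemma measure_cylinder:
  fixes u :: "real ^ 'n"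
  assumes u: "norm u = 1" and h: "0 \<le> h" and r: "0 < r"
  shows "{x. \<bar>x \<bullet> u\<bar> \<le> h \<and> norm (x - (x \<bullet> u) *\<^sub>R u) \<le> r} \<in> lmeasurable"
    "measure lebesgue {x. \<bar>x \<bullet> u\<bar> \<le> h \<and> norm (x - (x \<bullet> u) *\<^sub>R u) \<le> r}
      = 2 * h * (unit_ball_vol (real (CARD('n) - 1)) * r ^ (CARD('n) - 1))"
proof -
  define b :: "real ^ 'n" where "b = (SOME i. i \<in> Basis)"
  have b: "b \<in> Basis"
    unfolding b_def using SOME_Basis .
  let ?C = "{x::real^'n. \<bar>x \<bullet> b\<bar> \<le> h \<and> (\<Sum>i\<in>Basis - {b}. (x \<bullet> i)\<^sup>2) \<le> r\<^sup>2}"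
  obtain f where f: "orthogonal_transformation f" "f b = u"
    using orthogonal_transformation_exists_1[of b u] b u by auto
  let ?Z = "{x. \<bar>x \<bullet> u\<bar> \<le> h \<and> norm (x - (x \<bullet> u) *\<^sub>R u) \<le> r}"
  have Z: "?Z \<in> sets borel"
    by measurable
  have "f -` ?Z = ?C"
  proof -
    have "\<bar>f x \<bullet> u\<bar> \<le> h \<and> norm (f x - (f x \<bullet> u) *\<^sub>R u) \<le> r \<longleftrightarrow> x \<in> ?C" for x
    proof -
      have 1: "f x \<bullet> u = x \<bullet> b"
        using f by (metis orthogonal_transformation_def)
      have "(norm x)\<^sup>2 = (\<Sum>i\<in>Basis. (x \<bullet> i)\<^sup>2)"
        unfolding power2_norm_eq_inner using euclidean_inner[of x x] by (simp add: power2_eq_square)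
      also have "\<dots> = (x \<bullet> b)\<^sup>2 + (\<Sum>i\<in>Basis - {b}. (x \<bullet> i)\<^sup>2)"
        using b by (intro sum.remove) auto
      finally have "(norm (f x - (f x \<bullet> u) *\<^sub>R u))\<^sup>2 = (\<Sum>i\<in>Basis - {b}. (x \<bullet> i)\<^sup>2)"
        using norm_remove_component_sq[OF u, of "f x"] orthogonal_transformation_norm[OF f(1)] by (simp add: 1)
      moreover have "norm (f x - (f x \<bullet> u) *\<^sub>R u) \<le> r \<longleftrightarrow> (norm (f x - (f x \<bullet> u) *\<^sub>R u))\<^sup>2 \<le> r\<^sup>2"
        using r by (simp add: power2_le_iff_abs_le)
      ultimately show ?thesis
        by (simp add: 1)
    qed
    then show ?thesis
      by auto
  qed
  then have eZ: "emeasure lebesgue ?Z = ennreal (2 * h * (unit_ball_vol (real (CARD('n) - 1)) * r ^ (CARD('n) - 1)))"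
    using emeasure_orthogonal_vimage[OF f(1) Z] emeasure_axis_cylinder[OF b h r] Z by simp
  then show "?Z \<in> lmeasurable"
    using Z by (intro fmeasurableI) auto
  show "measure lebesgue ?Z = 2 * h * (unit_ball_vol (real (CARD('n) - 1)) * r ^ (CARD('n) - 1))"
    unfolding measure_def eZ using h r by (intro enn2real_ennreal) auto
qed

text \<open>
  The volume of the difference set of \<open>X\<close> is at least \<open>2\<^sup>d\<close> times that of \<open>X\<close>, and at most that of a
  round cylinder of half-height \<open>h\<close> and radius \<open>r\<close>.
\<close>

lemma isodiametric_cylinder:
  fixes X :: "(real ^ 'n) set" and u :: "real ^ 'n"
  assumes X: "compact X" and u: "norm u = 1" and r: "0 < r"
    and height: "\<And>x y. x \<in> X \<Longrightarrow> y \<in> X \<Longrightarrow> \<bar>(x - y) \<bullet> u\<bar> \<le> h"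
    and width: "\<And>x y. x \<in> X \<Longrightarrow> y \<in> X \<Longrightarrow> norm ((x - y) - ((x - y) \<bullet> u) *\<^sub>R u) \<le> r"
    and h: "0 \<le> h"
  shows "measure lebesgue X \<le> h * (unit_ball_vol (real (CARD('n) - 1)) / 2 ^ (CARD('n) - 1) * r ^ (CARD('n) - 1))"
proof -
  let ?C = "{x. \<bar>x \<bullet> u\<bar> \<le> h \<and> norm (x - (x \<bullet> u) *\<^sub>R u) \<le> r}"
  have "2 ^ CARD('n) * measure lebesgue X \<le> measure lebesgue {x - y | x y. x \<in> X \<and> y \<in> X}"
    using measure_difference_set_ge[OF X] by simp
  also have "\<dots> \<le> measure lebesgue ?C"
    using height width
    by (intro measure_mono_fmeasurable measure_cylinder[OF u h r] fmeasurableD lmeasurable_compact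
        compact_differences X) auto
  also have "\<dots> = 2 * h * (unit_ball_vol (real (CARD('n) - 1)) * r ^ (CARD('n) - 1))"
    by (rule measure_cylinder[OF u h r])
  finally have "2 * 2 ^ (CARD('n) - 1) * measure lebesgue X
      \<le> 2 * h * (unit_ball_vol (real (CARD('n) - 1)) * r ^ (CARD('n) - 1))"
    by (simp flip: power_Suc)
  then show ?thesis
    by (simp add: field_simps)
qed

section \<open>The volume swept out by a small set\<close>

definition tube :: "real ^ 'n ^ 'n \<Rightarrow> (real ^ 'n) set \<Rightarrow> (real ^ 'n) set" where
  "tube M B = (\<Union>a\<in>B. closed_segment a (M *v a))"

lemma tube_eq: "tube M B = (\<lambda>(t, a). a + t *\<^sub>R (M *v a - a)) ` ({0..1} \<times> B)"
  by (force simp: tube_def closed_segment_def algebra_simps image_iff)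

lemma compact_tube:
  assumes "compact B"
  shows "compact (tube M B)"
proof -
  have "continuous_on ({0..1} \<times> B) (\<lambda>p. M *v snd p)"
    by (intro bounded_linear.continuous_on[OF matrix_vector_mul_bounded_linear] continuous_intros)
  then have "continuous_on ({0..1} \<times> B) (\<lambda>p. snd p + fst p *\<^sub>R (M *v snd p - snd p))"
    by (intro continuous_intros)
  then show ?thesis
    unfolding tube_eq split_beta
    by (rule compact_continuous_image) (intro compact_Times assms compact_Icc)
qed

lemma norm_orthogonal_part_le:
  fixes u x :: "'a::real_inner"
  assumes "norm u = 1"
  shows "norm (x - (x \<bullet> u) *\<^sub>R u) \<le> norm x"
proof (rule power2_le_imp_le)
  show "(norm (x - (x \<bullet> u) *\<^sub>R u))\<^sup>2 \<le> (norm x)\<^sup>2"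
    using norm_remove_component_sq[OF assms, of x] by simp
qed simp

lemma norm_interpolation_le:
  fixes M :: "real ^ 'n ^ 'n"
  assumes M: "\<And>x. norm (M *v x) \<le> norm x" and t: "0 \<le> t" "t \<le> 1"
  shows "norm ((a + t *\<^sub>R (M *v a - a)) - (b + t *\<^sub>R (M *v b - b))) \<le> norm (a - b)"
proof -
  have "(a + t *\<^sub>R (M *v a - a)) - (b + t *\<^sub>R (M *v b - b)) = (1 - t) *\<^sub>R (a - b) + t *\<^sub>R (M *v (a - b))"
    by (simp add: matrix_vector_mult_diff_distrib algebra_simps)
  also have "norm \<dots> \<le> (1 - t) * norm (a - b) + t * norm (a - b)"
    using t M[of "a - b"] by (intro norm_triangle_le add_mono) (auto intro: mult_left_mono)
  finally show ?thesis
    by (simp add: algebra_simps)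
qed

lemma abs_inner_unit_le:
  fixes u x :: "'a::real_inner"
  assumes "norm u = 1"
  shows "\<bar>x \<bullet> u\<bar> \<le> norm x"
  using Cauchy_Schwarz_ineq2[of x u] assms by simp

text \<open>
  The volume of a ball of diameter one in dimension \<open>k\<close>, which is the normalising constant of the
  \<open>k\<close>-dimensional Hausdorff measure.
\<close>

abbreviation isodiametric_const :: "nat \<Rightarrow> real" where
  "isodiametric_const k \<equiv> unit_ball_vol (real k) / 2 ^ k"

text \<open>
  All points of the tube are within \<open>r\<close> of the segment that starts in \<open>a0\<close>, so the tube has height
  at most \<open>\<eta> + 2 r\<close> in the direction of this segment, and width at most \<open>2 r\<close>.  The factor
  \<open>2\<^sup>k\<close> that is lost here does no harm once \<open>\<eta>\<close> is small enough.
\<close>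

lemma measure_slow_tube:
  fixes M :: "real ^ 'n ^ 'n"
  assumes M: "\<And>x. norm (M *v x) \<le> norm x" 
    and B: "compact B" "\<And>a b. a \<in> B \<Longrightarrow> b \<in> B \<Longrightarrow> norm (a - b) \<le> r" "0 < r"
    and a0: "a0 \<in> B" "norm (M *v a0 - a0) \<le> \<eta>"
  shows "measure lebesgue (tube M B) \<le>
    (\<eta> + 2 * r) * (isodiametric_const (CARD('n) - 1) * (2 * r) ^ (CARD('n) - 1))"
proof -
  define v where "v = M *v a0 - a0"
  \<comment> \<open>If \<open>a0\<close> is a fixed point, any direction will do.\<close>
  define u where "u = (if v = 0 then axis undefined 1 else v /\<^sub>R norm v)"
  have u: "norm u = 1" "v = norm v *\<^sub>R u"
    by (auto simp: u_def norm_axis_1)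
  have *: "\<bar>(x - y) \<bullet> u\<bar> \<le> \<eta> + 2 * r \<and> norm ((x - y) - ((x - y) \<bullet> u) *\<^sub>R u) \<le> 2 * r"
    if xy: "x \<in> tube M B" "y \<in> tube M B" for x y
  proof -
    obtain t a where ta: "x = a + t *\<^sub>R (M *v a - a)" "a \<in> B" "0 \<le> t" "t \<le> 1"
      using xy(1) unfolding tube_eq by auto
    obtain s b where sb: "y = b + s *\<^sub>R (M *v b - b)" "b \<in> B" "0 \<le> s" "s \<le> 1"
      using xy(2) unfolding tube_eq by auto
    define z where "z = (x - (a0 + t *\<^sub>R v)) - (y - (a0 + s *\<^sub>R v))"
    have z: "norm z \<le> 2 * r"
    proof -
      have "norm (x - (a0 + t *\<^sub>R v)) \<le> r"
        using norm_interpolation_le[OF M ta(3,4), of a a0] B(2)[OF ta(2) a0(1)] by (simp add: ta v_def)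
      moreover have "norm (y - (a0 + s *\<^sub>R v)) \<le> r"
        using norm_interpolation_le[OF M sb(3,4), of b a0] B(2)[OF sb(2) a0(1)] by (simp add: sb v_def)
      ultimately show ?thesis
        unfolding z_def using norm_triangle_ineq4[of "x - (a0 + t *\<^sub>R v)" "y - (a0 + s *\<^sub>R v)"] by linarith
    qed
    have xyz: "x - y = z + ((t - s) * norm v) *\<^sub>R u"
      unfolding z_def using u(2) by (simp add: algebra_simps flip: scaleR_scaleR)
    have uu: "u \<bullet> u = 1"
      using u(1) by (simp add: dot_square_norm)
    have "\<bar>(x - y) \<bullet> u\<bar> \<le> \<bar>z \<bullet> u\<bar> + \<bar>(t - s) * norm v\<bar>"
      unfolding xyz by (simp add: inner_add_left uu)
    also have "\<bar>z \<bullet> u\<bar> \<le> 2 * r"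
      using abs_inner_unit_le[OF u(1), of z] z by linarith
    also have "\<bar>(t - s) * norm v\<bar> \<le> 1 * \<eta>"
      unfolding abs_mult using ta sb a0(2) by (intro mult_mono) (auto simp: v_def)
    finally have 1: "\<bar>(x - y) \<bullet> u\<bar> \<le> \<eta> + 2 * r"
      by simp
    have "(x - y) - ((x - y) \<bullet> u) *\<^sub>R u = z - (z \<bullet> u) *\<^sub>R u"
      unfolding xyz by (simp add: inner_add_left uu algebra_simps)
    then show ?thesis
      using 1 norm_orthogonal_part_le[OF u(1), of z] z by simp
  qed
  have "0 \<le> \<eta>"
    using a0(2) norm_ge_zero order_trans by blast
  then show ?thesis
    using * B by (intro isodiametric_cylinder[OF compact_tube u(1)]) auto
qed

text \<open>
  The sharp estimate.  The tube is cut into slabs of height \<open>r\<close> orthogonal to \<open>v = M a0 - a0\<close>.  Two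
  points \<open>a + t (M a - a)\<close> and \<open>b + s (M b - b)\<close> of the same slab satisfy \<open>\<bar>t - s\<bar> = O(r / \<eta>)\<close>,
  because at equal times \<open>t = s\<close> such points differ in height by at most \<open>r\<close>, and with increasing time
  they move with speed at least \<open>\<eta> / 2\<close> in the direction of \<open>v\<close>.  The velocity orthogonal to \<open>v\<close> is at most \<open>2 r\<close>, so this
  difference in time changes the width of the slab by a quantity of order \<open>r\<^sup>2\<close> only, which leaves
  the leading term \<open>r\<^sup>k\<close> with its optimal constant.
\<close>

lemma measure_fast_tube:
  fixes M :: "real ^ 'n ^ 'n"
  assumes M: "\<And>x. norm (M *v x) \<le> norm x" 
    and B: "compact B" "\<And>a b. a \<in> B \<Longrightarrow> b \<in> B \<Longrightarrow> norm (a - b) \<le> r" "0 < r" 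
    and a0: "a0 \<in> B" "\<eta> \<le> norm (M *v a0 - a0)" "norm (M *v a0 - a0) \<le> w"
    and \<eta>: "0 < \<eta>" "4 * r \<le> \<eta>"
  shows "measure lebesgue (tube M B) \<le>
    (w + 3 * r) * (isodiametric_const (CARD('n) - 1) * (r * (1 + 8 * r / \<eta>)) ^ (CARD('n) - 1))"
proof -
  define v where "v = M *v a0 - a0"
  define u where "u = v /\<^sub>R norm v"
  have v: "norm v > 0"
    unfolding v_def using \<eta>(1) a0(2) by (rule less_le_trans)
  then have u: "norm u = 1" "v = norm v *\<^sub>R u"
    by (auto simp: u_def)
  have uu: "u \<bullet> u = 1"
    using u(1) by (simp add: dot_square_norm)
  have vu: "v \<bullet> u = norm v" 
    using uu by (subst u(2)) simp
  \<comment> \<open>The lowest height that can occur is that of \<open>a0\<close> minus \<open>r\<close>, and the heights range over an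
    interval of length at most \<open>w + 2 r\<close>; one further slab of height \<open>r\<close> may be needed for rounding.\<close>
  define s0 where "s0 = a0 \<bullet> u - r"
  define slab where "slab j = tube M B \<inter> {x. s0 + real j * r \<le> x \<bullet> u} \<inter> {x. x \<bullet> u \<le> s0 + real (Suc j) * r}" for j
  define N where "N = nat \<lfloor>(w + 2 * r) / r\<rfloor>"
  let ?D = "r * (1 + 8 * r / \<eta>)"
  let ?c = "isodiametric_const (CARD('n) - 1) * ?D ^ (CARD('n) - 1)"
  have w: "0 \<le> w"
    using a0(3) norm_ge_zero order_trans by blast
  have slab: "compact (slab j)" for j
    unfolding slab_def
    by (intro compact_Int_closed compact_tube B(1))
       (auto simp: inner_commute[of _ u] closed_halfspace_le closed_halfspace_ge)
  have D: "0 < ?D"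
    using B(3) \<eta> by (simp add: add_pos_pos)
  have slab_le: "measure lebesgue (slab j) \<le> r * ?c" for j
  proof (rule isodiametric_cylinder[OF slab u(1) D])
    fix x y assume xy: "x \<in> slab j" "y \<in> slab j"
    show h: "\<bar>(x - y) \<bullet> u\<bar> \<le> r"
      using xy by (auto simp: slab_def inner_diff_left algebra_simps)
    obtain t a where ta: "x = a + t *\<^sub>R (M *v a - a)" "a \<in> B" "0 \<le> t" "t \<le> 1"
      using xy(1) unfolding slab_def tube_eq by auto
    obtain s b where sb: "y = b + s *\<^sub>R (M *v b - b)" "b \<in> B" "0 \<le> s" "s \<le> 1"
      using xy(2) unfolding slab_def tube_eq by auto
    define z where "z = x - (b + t *\<^sub>R (M *v b - b))"
    have z: "norm z \<le> r"
      using norm_interpolation_le[OF M ta(3,4), of a b] B(2)[OF ta(2) sb(2)] by (simp add: ta z_def)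
    define q where "q = M *v b - b - v"
    have q: "norm q \<le> 2 * r"
    proof -
      have "q = M *v (b - a0) - (b - a0)"
        by (simp add: q_def v_def matrix_vector_mult_diff_distrib)
      also have "norm \<dots> \<le> norm (b - a0) + norm (b - a0)"
        using M[of "b - a0"] norm_triangle_ineq4[of "M *v (b - a0)" "b - a0"] by linarith
      finally show ?thesis
        using B(2)[OF sb(2) a0(1)] by simp
    qed
    have xyz: "x - y = z + (t - s) *\<^sub>R (q + v)"
      unfolding z_def q_def sb by (simp add: algebra_simps)
    have "\<eta> / 2 \<le> (q + v) \<bullet> u"
      using abs_inner_unit_le[OF u(1), of q] q a0(2) \<eta> by (simp add: inner_add_left vu) (simp add: v_def)
    then have "\<bar>t - s\<bar> * (\<eta> / 2) \<le> \<bar>t - s\<bar> * ((q + v) \<bullet> u)"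
      by (intro mult_left_mono) auto
    also have "\<dots> = \<bar>(t - s) * ((q + v) \<bullet> u)\<bar>"
      using \<open>\<eta> / 2 \<le> (q + v) \<bullet> u\<close> \<eta> by (simp add: abs_mult)
    also have "(t - s) * ((q + v) \<bullet> u) = (x - y) \<bullet> u - z \<bullet> u"
      by (simp add: xyz inner_add_left)
    also have "\<bar>\<dots>\<bar> \<le> 2 * r"
      using h abs_inner_unit_le[OF u(1), of z] z by linarith
    finally have ts: "\<bar>t - s\<bar> \<le> 4 * r / \<eta>"
      using \<eta> by (simp add: field_simps)
    have "c *\<^sub>R v = (c * norm v) *\<^sub>R u" for c
      using u(2) by (metis scaleR_scaleR)
    then have "(x - y) - ((x - y) \<bullet> u) *\<^sub>R u = (z - (z \<bullet> u) *\<^sub>R u) + (t - s) *\<^sub>R (q - (q \<bullet> u) *\<^sub>R u)"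
      unfolding xyz by (simp add: inner_add_left vu uu algebra_simps)
    also have "norm \<dots> \<le> norm z + \<bar>t - s\<bar> * norm q"
      using norm_orthogonal_part_le[OF u(1), of z] norm_orthogonal_part_le[OF u(1), of q]
      by (intro norm_triangle_le add_mono) (auto intro: mult_left_mono)
    also have "\<dots> \<le> r + (4 * r / \<eta>) * (2 * r)"
      using z q ts B(3) \<eta> by (intro add_mono mult_mono) auto
    finally show "norm ((x - y) - ((x - y) \<bullet> u) *\<^sub>R u) \<le> ?D"
      by (simp add: algebra_simps)
  qed (use B in auto)
  have cover: "tube M B \<subseteq> (\<Union>j\<in>{..N}. slab j)"
  proof
    fix x assume x: "x \<in> tube M B"
    then obtain t a where ta: "x = a + t *\<^sub>R (M *v a - a)" "a \<in> B" "0 \<le> t" "t \<le> 1"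
      unfolding tube_eq by auto
    define z where "z = x - (a0 + t *\<^sub>R v)"
    have "norm z \<le> r"
      using norm_interpolation_le[OF M ta(3,4), of a a0] B(2)[OF ta(2) a0(1)] by (simp add: ta z_def v_def)
    then have zu: "\<bar>z \<bullet> u\<bar> \<le> r"
      using abs_inner_unit_le[OF u(1), of z] by linarith
    have xu: "x \<bullet> u - s0 = z \<bullet> u + r + t * norm v"
      by (simp add: z_def s0_def inner_diff_left inner_add_left vu)
    have "t * norm v \<le> 1 * w"
      using ta a0(3) by (intro mult_mono) (auto simp: v_def)
    then have b: "0 \<le> x \<bullet> u - s0" "x \<bullet> u - s0 \<le> w + 2 * r"
      using zu xu ta v by auto
    define j where "j = nat \<lfloor>(x \<bullet> u - s0) / r\<rfloor>"
    have "0 \<le> (x \<bullet> u - s0) / r"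
      using b B(3) by simp
    then have "real j \<le> (x \<bullet> u - s0) / r" "(x \<bullet> u - s0) / r \<le> real (Suc j)"
      unfolding j_def by linarith+
    then have "x \<in> slab j"
      using x B(3) by (simp add: slab_def field_simps)
    moreover have "j \<le> N"
      unfolding j_def N_def using b B(3) by (intro nat_mono floor_mono divide_right_mono) auto
    ultimately show "x \<in> (\<Union>j\<in>{..N}. slab j)"
      by auto
  qed
  have "measure lebesgue (tube M B) \<le> measure lebesgue (\<Union>j\<in>{..N}. slab j)"
    by (intro measure_mono_fmeasurable cover lmeasurable_compact fmeasurableD compact_tube compact_UN slab B(1)) auto
  also have "\<dots> \<le> (\<Sum>j\<in>{..N}. measure lebesgue (slab j))"
    by (intro measure_UNION_le) (auto intro: fmeasurableD lmeasurable_compact slab)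
  also have "\<dots> \<le> (\<Sum>j\<in>{..N}. r * ?c)"
    by (intro sum_mono slab_le)
  also have "\<dots> = (real (Suc N) * r) * ?c"
    by simp
  also have "\<dots> \<le> (w + 3 * r) * ?c"
  proof (rule mult_right_mono)
    have "0 \<le> (w + 2 * r) / r"
      using w B(3) by simp
    then have "real N \<le> (w + 2 * r) / r"
      unfolding N_def by linarith
    then show "real (Suc N) * r \<le> w + 3 * r"
      using B(3) by (simp add: field_simps)
    show "0 \<le> ?c"
      using D by simp
  qed
  finally show ?thesis .
qed

text \<open>
  The threshold \<open>\<eta>\<close> between the slow and the fast case may depend on \<open>W\<close> but not on \<open>B\<close>: it is chosen
  such that the slow case gives the bound \<open>W\<close>, and then \<open>r\<close> is made small enough for the fast case.
  The two previous estimates need \<open>r > 0\<close>.  The value \<open>r = 0\<close>, which occurs since single points are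
  admissible covering sets, follows by continuity of the bound in \<open>r\<close>.
\<close>

lemma measure_small_tube:
  fixes M :: "real ^ 'n ^ 'n"
  assumes M: "\<And>x. norm (M *v x) \<le> norm x" and W: "0 \<le> w" "w < W"
  obtains \<delta> where "0 < \<delta>"
    "\<And>B r. compact B \<Longrightarrow> (\<And>a b. a \<in> B \<Longrightarrow> b \<in> B \<Longrightarrow> norm (a - b) \<le> r) \<Longrightarrow> 0 \<le> r \<Longrightarrow> r < \<delta> \<Longrightarrow>
        (\<And>a. a \<in> B \<Longrightarrow> norm (M *v a - a) \<le> w) \<Longrightarrow>
        measure lebesgue (tube M B) \<le> W * (isodiametric_const (CARD('n) - 1) * r ^ (CARD('n) - 1))"
proof -
  let ?k = "CARD('n) - 1"
  let ?c = "isodiametric_const ?k"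
  define \<eta> where "\<eta> = W / (2 * 2 ^ ?k)"
  have \<eta>: "0 < \<eta>"
    using W by (simp add: \<eta>_def)
  have "((\<lambda>r. (w + 3 * r) * (1 + 8 * r / \<eta>) ^ ?k) \<longlongrightarrow> (w + 3 * 0) * (1 + 8 * 0 / \<eta>) ^ ?k) (at_right 0)"
    by (intro tendsto_intros) (use \<eta> in auto)
  then have "\<forall>\<^sub>F r in at_right 0. (w + 3 * r) * (1 + 8 * r / \<eta>) ^ ?k < W"
    using W by (intro order_tendstoD) auto
  then obtain \<delta>1 where \<delta>1: "0 < \<delta>1" "\<And>r. 0 < r \<Longrightarrow> r < \<delta>1 \<Longrightarrow> (w + 3 * r) * (1 + 8 * r / \<eta>) ^ ?k < W"
    unfolding eventually_at_right_field by auto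
  \<comment> \<open>The second bound gives \<open>4 r \<le> \<eta>\<close>, as the fast case demands, and \<open>\<eta> + 2 r \<le> 2 \<eta>\<close>, where
    \<open>2 \<eta> 2\<^sup>k = W\<close>.\<close>
  define \<delta> where "\<delta> = min \<delta>1 (\<eta> / 4)"
  have pos: "measure lebesgue (tube M B) \<le> W * (?c * r ^ ?k)"
    if B: "compact B" "\<And>a b. a \<in> B \<Longrightarrow> b \<in> B \<Longrightarrow> norm (a - b) \<le> r" and r: "0 < r" "r < \<delta>"
      and w: "\<And>a. a \<in> B \<Longrightarrow> norm (M *v a - a) \<le> w" for B r
  proof (cases "B = {}")
    case True
    then show ?thesis
      using W r by (simp add: tube_def)
  next
    case False
    then obtain a0 where a0: "a0 \<in> B" by blast
    have c: "0 \<le> ?c * r ^ ?k"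
      using r by simp
    show ?thesis
    proof (cases "norm (M *v a0 - a0) \<le> \<eta>")
      case True
      have "measure lebesgue (tube M B) \<le> (\<eta> + 2 * r) * (?c * (2 * r) ^ ?k)"
        by (rule measure_slow_tube[OF M B r(1) a0 True])
      also have "\<dots> = ((\<eta> + 2 * r) * 2 ^ ?k) * (?c * r ^ ?k)"
        by (simp add: power_mult_distrib)
      also have "\<dots> \<le> W * (?c * r ^ ?k)"
      proof (rule mult_right_mono[OF _ c])
        have "(\<eta> + 2 * r) * 2 ^ ?k \<le> (2 * \<eta>) * 2 ^ ?k"
          using r \<eta> by (intro mult_right_mono) (auto simp: \<delta>_def)
        also have "\<dots> = W"
          by (simp add: \<eta>_def)
        finally show "(\<eta> + 2 * r) * 2 ^ ?k \<le> W" .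
      qed
      finally show ?thesis .
    next
      case False
      then have "measure lebesgue (tube M B) \<le> (w + 3 * r) * (?c * (r * (1 + 8 * r / \<eta>)) ^ ?k)"
        using r by (intro measure_fast_tube[OF M B r(1) a0 _ w \<eta>] a0) (auto simp: \<delta>_def)
      also have "\<dots> = ((w + 3 * r) * (1 + 8 * r / \<eta>) ^ ?k) * (?c * r ^ ?k)"
        by (simp only: power_mult_distrib mult_ac)
      also have "\<dots> \<le> W * (?c * r ^ ?k)"
        using \<delta>1(2)[of r] r by (intro mult_right_mono[OF _ c]) (auto simp: \<delta>_def)
      finally show ?thesis .
    qed
  qed
  show thesis
  proof (rule that)
    show "0 < \<delta>"
      using \<delta>1 \<eta> by (simp add: \<delta>_def)
    fix B r
    assume B: "compact B" "\<And>a b. a \<in> B \<Longrightarrow> b \<in> B \<Longrightarrow> norm (a - b) \<le> r" and r: "0 \<le> r" "r < \<delta>"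
      and w: "\<And>a. a \<in> B \<Longrightarrow> norm (M *v a - a) \<le> w"
    show "measure lebesgue (tube M B) \<le> W * (?c * r ^ ?k)"
    proof (rule tendsto_lowerbound)
      show "((\<lambda>\<rho>. W * (?c * \<rho> ^ ?k)) \<longlongrightarrow> W * (?c * r ^ ?k)) (at_right r)"
        by (intro tendsto_intros)
      have "\<forall>\<^sub>F \<rho> in at_right r. r < \<rho> \<and> \<rho> < \<delta>"
        unfolding eventually_at_right_field using r by blast
      then show "\<forall>\<^sub>F \<rho> in at_right r. measure lebesgue (tube M B) \<le> W * (?c * \<rho> ^ ?k)"
        by eventually_elim (rule pos, use B(1) w r in \<open>auto intro: order_trans[OF B(2)]\<close>)
    qed simp
  qed
qed

section \<open>Comparison of Hausdorff and Lebesgue measure\<close>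

lemma hausdorff_delta_antimono:
  assumes "\<delta> \<le> \<delta>'"
  shows "hausdorff_delta k \<delta>' A \<le> hausdorff_delta k \<delta> A"
  unfolding hausdorff_delta_def
proof (intro mult_left_mono Inf_superset_mono Collect_mono impI)
  fix s
  assume "\<exists>B. s = (\<Sum>j. if B j = {} then 0 else ennreal (diameter (B j) ^ k)) \<and>
    (\<forall>j. bounded (B j) \<and> diameter (B j) \<le> \<delta>) \<and> A \<subseteq> (\<Union>j::nat. B j)"
  then show "\<exists>B. s = (\<Sum>j. if B j = {} then 0 else ennreal (diameter (B j) ^ k)) \<and>
    (\<forall>j. bounded (B j) \<and> diameter (B j) \<le> \<delta>') \<and> A \<subseteq> (\<Union>j::nat. B j)"
    by (elim exE conjE, intro exI conjI allI) (auto intro: order_trans[OF _ assms])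
qed simp

text \<open>
  By monotonicity the one-sided limit in the definition exists and is a supremum, so that bounds on
  \<open>hausdorff_delta\<close> for all \<open>\<delta>\<close> can be turned into bounds on the measure and conversely.
\<close>

lemma hausdorff_measure_eq_SUP:
  "hausdorff_measure k A = (SUP \<delta>\<in>{0<..}. hausdorff_delta k \<delta> A)"
proof -
  have "((\<lambda>\<delta>. hausdorff_delta k \<delta> A) \<longlongrightarrow> (SUP \<delta>\<in>{0<..}. hausdorff_delta k \<delta> A)) (at_right 0)"
  proof (rule order_tendstoI)
    fix a assume "a < (SUP \<delta>\<in>{0<..}. hausdorff_delta k \<delta> A)"
    then obtain \<delta> where \<delta>: "0 < \<delta>" "a < hausdorff_delta k \<delta> A"
      by (auto simp: less_SUP_iff)
    have "a < hausdorff_delta k \<rho> A" if "\<rho> < \<delta>" for \<rho>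
      using hausdorff_delta_antimono[of \<rho> \<delta> k A] that \<delta>(2) by (simp add: less_le_trans)
    then show "\<forall>\<^sub>F \<rho> in at_right 0. a < hausdorff_delta k \<rho> A"
      unfolding eventually_at_right_field using \<delta>(1) by blast
  next
    fix a assume a: "(SUP \<delta>\<in>{0<..}. hausdorff_delta k \<delta> A) < a"
    have "hausdorff_delta k \<rho> A < a" if "0 < \<rho>" for \<rho>
      using that by (intro le_less_trans[OF SUP_upper a]) auto
    then show "\<forall>\<^sub>F \<rho> in at_right 0. hausdorff_delta k \<rho> A < a"
      unfolding eventually_at_right_field using zero_less_one by blast
  qed
  then show ?thesis
    unfolding hausdorff_measure_def by (intro tendsto_Lim) auto
qed

text \<open>
  Covers by countable families with any index set are as good as sequences; the sequence is filled up
  with empty sets, which contribute nothing.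
\<close>

lemma hausdorff_delta_le_countable_cover:
  assumes I: "countable I" and A: "A \<subseteq> (\<Union>i\<in>I. S i)"
    and S: "\<And>i. i \<in> I \<Longrightarrow> bounded (S i) \<and> diameter (S i) \<le> \<delta>" and \<delta>: "0 \<le> \<delta>"
  shows "hausdorff_delta k \<delta> A \<le> 
    (\<integral>\<^sup>+i. ennreal (unit_ball_vol (real k) / 2 ^ k) * ennreal (diameter (S i) ^ k) \<partial>count_space I)"
proof -
  define J where "J = to_nat_on I ` I"
  define B where "B j = (if j \<in> J then S (from_nat_into I j) else {})" for j
  let ?g = "\<lambda>X. if X = {} then 0 else ennreal (diameter X ^ k)"
  have B: "A \<subseteq> (\<Union>j. B j)" "\<And>j. bounded (B j) \<and> diameter (B j) \<le> \<delta>"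
    using A S I \<delta> by (fastforce simp: B_def J_def)+
  have "(\<Sum>j. ?g (B j)) = (\<integral>\<^sup>+j. ?g (B j) \<partial>count_space UNIV)"
    by (simp add: nn_integral_count_space_nat)
  also have "\<dots> = (\<integral>\<^sup>+j. ?g (B j) \<partial>count_space J)"
    by (rule nn_integral_count_space_eq) (auto simp: B_def)
  also have "\<dots> = (\<integral>\<^sup>+i. ?g (B (to_nat_on I i)) \<partial>count_space I)"
    unfolding J_def using I 
    by (intro nn_integral_bij_count_space[symmetric] inj_on_imp_bij_betw inj_on_to_nat_on)
  also have "\<dots> \<le> (\<integral>\<^sup>+i. ennreal (diameter (S i) ^ k) \<partial>count_space I)"
    using I by (intro nn_integral_mono) (auto simp: B_def J_def)
  finally have "(\<Sum>j. ?g (B j)) \<le> (\<integral>\<^sup>+i. ennreal (diameter (S i) ^ k) \<partial>count_space I)" .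
  moreover have "Inf {(\<Sum>j. ?g (B j)) | B :: nat \<Rightarrow> _ set.
            (\<forall>j. bounded (B j) \<and> diameter (B j) \<le> \<delta>) \<and> A \<subseteq> (\<Union>j. B j)} \<le> (\<Sum>j. ?g (B j))"
    using B by (intro Inf_lower) blast
  ultimately show ?thesis
    unfolding hausdorff_delta_def 
    by (subst nn_integral_cmult) (auto intro!: mult_left_mono elim: order_trans)
qed

lemma emeasure_cball_diameter:
  fixes x :: "'a::euclidean_space"
  assumes "0 \<le> r"
  shows "ennreal (unit_ball_vol (real DIM('a)) / 2 ^ DIM('a)) * ennreal (diameter (cball x r) ^ DIM('a))
    = emeasure lborel (cball x r)"
  using assms by (simp add: emeasure_cball power_mult_distrib flip: ennreal_mult)

lemma hausdorff_delta_le_balls: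
  fixes X :: "'a::euclidean_space set" and C :: "('a \<times> real) set"
  assumes C: "countable C" and X: "X \<subseteq> (\<Union>(x,r)\<in>C. cball x r)"
    and r: "\<And>x r. (x, r) \<in> C \<Longrightarrow> 0 < r \<and> 2 * r \<le> \<delta>" and \<delta>: "0 \<le> \<delta>"
  shows "hausdorff_delta DIM('a) \<delta> X \<le> (\<integral>\<^sup>+(x,r). emeasure lborel (cball x r) \<partial>count_space C)"
proof -
  have "hausdorff_delta DIM('a) \<delta> X \<le> (\<integral>\<^sup>+i. ennreal (unit_ball_vol (real DIM('a)) / 2 ^ DIM('a)) *
      ennreal (diameter (case i of (x, r) \<Rightarrow> cball x r) ^ DIM('a)) \<partial>count_space C)"
    using X r by (intro hausdorff_delta_le_countable_cover C \<delta>) (auto simp: diameter_cball \<delta>)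
  also have "\<dots> = (\<integral>\<^sup>+(x,r). emeasure lborel (cball x r) \<partial>count_space C)"
  proof (rule nn_integral_cong)
    fix i assume "i \<in> space (count_space C)"
    moreover obtain x \<rho> where "i = (x, \<rho>)"
      by (cases i)
    ultimately show "ennreal (unit_ball_vol (real DIM('a)) / 2 ^ DIM('a)) *
        ennreal (diameter (case i of (x, r) \<Rightarrow> cball x r) ^ DIM('a)) = (case i of (x, r) \<Rightarrow> emeasure lborel (cball x r))"
      using r[of x \<rho>] emeasure_cball_diameter[of \<rho> x] by simp
  qed
  finally show ?thesis .
qed

lemma nn_integral_disjoint_balls_le:
  fixes U :: "'a::euclidean_space set"
  assumes C: "countable C" "pairwise (\<lambda>i j. disjnt (cball (fst i) (snd i)) (cball (fst j) (snd j))) C"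
    and U: "\<And>x r. (x, r) \<in> C \<Longrightarrow> cball x r \<subseteq> U" "U \<in> sets borel"
  shows "(\<integral>\<^sup>+(x,r). emeasure lborel (cball x r) \<partial>count_space C) \<le> emeasure lborel U"
proof -
  have "(\<integral>\<^sup>+(x,r). emeasure lborel (cball x r) \<partial>count_space C) =
      (\<integral>\<^sup>+i. emeasure lborel (cball (fst i) (snd i)) \<partial>count_space C)"
    by (simp add: case_prod_unfold)
  also have "\<dots> = emeasure lborel (\<Union>i\<in>C. cball (fst i) (snd i))"
    using C by (intro emeasure_UN_countable[symmetric]) (auto simp: disjoint_family_on_def pairwise_def disjnt_def)
  also have "\<dots> \<le> emeasure lborel U"
  proof (intro emeasure_mono UN_least)
    show "cball (fst i) (snd i) \<subseteq> U" if "i \<in> C" for i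
      using U(1)[of "fst i" "snd i"] that by simp
  qed (use U in simp)
  finally show ?thesis .
qed

text \<open>
  For balls the \<open>d\<close>-dimensional covering sum equals the sum of the volumes.  By the Vitali covering
  theorem, disjoint small balls inside an open set slightly larger than \<open>X\<close> cover \<open>X\<close> up to a null set
  \<open>N\<close>.  This null set is covered by five-fold enlargements of disjoint balls in an open set of small
  volume, which costs at most a factor \<open>5\<^sup>d\<close> of that volume.
\<close>

lemma hausdorff_measure_le_lebesgue:
  fixes X :: "'a::euclidean_space set"
  assumes X: "X \<in> sets lebesgue"
  shows "hausdorff_measure DIM('a) X \<le> emeasure lebesgue X"
  unfolding hausdorff_measure_eq_SUP
proof (rule SUP_least)
  fix \<delta> :: real assume "\<delta> \<in> {0<..}"
  then have \<delta>: "0 < \<delta>" by simp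
  have outer: "\<exists>U. open U \<and> S \<subseteq> U \<and> emeasure lborel U \<le> emeasure lebesgue S + ennreal \<epsilon>"
    if S: "S \<in> sets lebesgue" and "0 < \<epsilon>" for S :: "'a set" and \<epsilon>
  proof -
    obtain U where U: "open U" "S \<subseteq> U" "U - S \<in> lmeasurable" "emeasure lebesgue (U - S) < ennreal \<epsilon>"
      by (rule sets_lebesgue_outer_open[OF S \<open>0 < \<epsilon>\<close>])
    have "emeasure lborel U = emeasure lebesgue (S \<union> (U - S))"
      using U(1,2) by (simp add: Un_absorb1)
    also have "\<dots> \<le> emeasure lebesgue S + emeasure lebesgue (U - S)"
      using S U(3) by (intro emeasure_subadditive) (auto simp: fmeasurableD)
    also have "\<dots> \<le> emeasure lebesgue S + ennreal \<epsilon>"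
      using U(4) by (intro add_left_mono) simp
    finally show ?thesis
      using U by blast
  qed
  have *: "hausdorff_delta DIM('a) \<delta> X \<le> emeasure lebesgue X + ennreal ((1 + 5 ^ DIM('a)) * \<epsilon>)" if \<epsilon>: "0 < \<epsilon>" for \<epsilon>
  proof -
    obtain U where U: "open U" "X \<subseteq> U" "emeasure lborel U \<le> emeasure lebesgue X + ennreal \<epsilon>"
      using outer[OF X \<epsilon>] by blast
    define K where "K = {(x, r). 0 < r \<and> 2 * r \<le> \<delta> \<and> cball x r \<subseteq> U}"
    obtain C where C: "countable C" "C \<subseteq> K"
      "pairwise (\<lambda>i j. disjnt (cball (fst i) (snd i)) (cball (fst j) (snd j))) C"
      "negligible (X - (\<Union>i \<in> C. cball (fst i) (snd i)))"
    proof (rule Vitali_covering_theorem_cballs)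
      show "0 < snd i" if "i \<in> K" for i
        using that by (auto simp: K_def)
      fix x d :: _ assume x: "x \<in> X" and d: "0 < (d::real)"
      obtain e where e: "e > 0" "cball x e \<subseteq> U"
        using U x open_contains_cball by blast
      have "(x, min e (min (d / 2) (\<delta> / 2))) \<in> K"
        using e d \<delta> by (auto simp: K_def)
      then show "\<exists>i. i \<in> K \<and> x \<in> cball (fst i) (snd i) \<and> snd i < d"
        using d e \<delta> by (intro exI[of _ "(x, min e (min (d / 2) (\<delta> / 2)))"]) auto
    qed
    define N where "N = X - (\<Union>i \<in> C. cball (fst i) (snd i))"
    have "emeasure lebesgue N = 0" "N \<in> sets lebesgue"
      using C(4) by (auto simp: N_def negligible_iff_null_sets)
    then obtain V where V: "open V" "N \<subseteq> V" "emeasure lborel V \<le> ennreal \<epsilon>"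
      using outer[of N, OF _ \<epsilon>] by auto
    \<comment> \<open>The bound \<open>10 r \<le> \<delta>\<close> keeps the diameter of the five-fold enlargement at most \<open>\<delta>\<close>.\<close>
    define K' where "K' = {(x, r). 0 < r \<and> 10 * r \<le> \<delta> \<and> cball x r \<subseteq> V}"
    obtain C' where C': "countable C'" "C' \<subseteq> K'"
      "pairwise (\<lambda>i j. disjnt (cball (fst i) (snd i)) (cball (fst j) (snd j))) C'"
      "N \<subseteq> (\<Union>i \<in> C'. cball (fst i) (5 * snd i))"
    proof (rule Vitali_covering_lemma_cballs)
      show "0 < snd i \<and> snd i \<le> \<delta>" if "i \<in> K'" for i
        using that by (auto simp: K'_def)
      show "N \<subseteq> (\<Union>i\<in>K'. cball (fst i) (snd i))"
      proof
        fix x assume "x \<in> N"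
        then obtain e where e: "e > 0" "cball x e \<subseteq> V"
          using V open_contains_cball by blast
        then have "(x, min e (\<delta> / 10)) \<in> K'"
          using \<delta> by (auto simp: K'_def)
        then show "x \<in> (\<Union>i\<in>K'. cball (fst i) (snd i))"
          using e \<delta> by (intro UN_I[of "(x, min e (\<delta> / 10))"]) auto
      qed
    qed
    define D where "D = (\<lambda>(x, r). (x, 5 * r)) ` C'"
    have inj: "inj_on (\<lambda>(x, r). (x, 5 * r)) C'"
      by (auto simp: inj_on_def)
    let ?f = "\<lambda>(x::'a, r). emeasure lborel (cball x r)"
    have "hausdorff_delta DIM('a) \<delta> X \<le> (\<integral>\<^sup>+i. ?f i \<partial>count_space (C \<union> D))"
    proof (rule hausdorff_delta_le_balls)
      show "countable (C \<union> D)"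
        using C C' by (simp add: D_def)
      show "X \<subseteq> (\<Union>(x, r)\<in>C \<union> D. cball x r)"
      proof
        fix x assume "x \<in> X"
        then have "x \<in> (\<Union>i\<in>C. cball (fst i) (snd i)) \<or> x \<in> N"
          by (auto simp: N_def)
        then show "x \<in> (\<Union>(x, r)\<in>C \<union> D. cball x r)"
          using C'(4) by (fastforce simp: D_def split_beta)
      qed
      show "0 < r \<and> 2 * r \<le> \<delta>" if "(x, r) \<in> C \<union> D" for x r
        using that C(2) C'(2) by (auto simp: D_def K_def K'_def)
    qed (use \<delta> in simp)
    also have "\<dots> \<le> (\<integral>\<^sup>+i. ?f i \<partial>count_space C) + (\<integral>\<^sup>+i. ?f i \<partial>count_space D)"
      by (auto simp: nn_integral_count_space_indicator simp flip: nn_integral_add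
          intro!: nn_integral_mono split: split_indicator)
    also have "(\<integral>\<^sup>+i. ?f i \<partial>count_space D) = (\<integral>\<^sup>+(x, r). emeasure lborel (cball x (5 * r)) \<partial>count_space C')"
      unfolding D_def using inj
      by (subst nn_integral_bij_count_space[symmetric, OF inj_on_imp_bij_betw]) (auto simp: case_prod_unfold)
    also have "\<dots> = (\<integral>\<^sup>+i. 5 ^ DIM('a) * ?f i \<partial>count_space C')"
    proof (rule nn_integral_cong, clarsimp)
      fix x :: 'a and r assume "(x, r) \<in> C'"
      then have "0 < r"
        using C'(2) by (auto simp: K'_def)
      then show "emeasure lborel (cball x (5 * r)) = 5 ^ DIM('a) * emeasure lborel (cball x r)"
        by (simp add: emeasure_cball power_mult_distrib ennreal_mult mult_ac flip: ennreal_power)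
    qed
    also have "\<dots> = 5 ^ DIM('a) * (\<integral>\<^sup>+i. ?f i \<partial>count_space C')"
      by (simp add: nn_integral_cmult)
    also have "(\<integral>\<^sup>+i. ?f i \<partial>count_space C') \<le> ennreal \<epsilon>"
      using C' V by (intro order_trans[OF nn_integral_disjoint_balls_le[of C' V] V(3)]) (auto simp: K'_def)
    also have "(\<integral>\<^sup>+i. ?f i \<partial>count_space C) \<le> emeasure lebesgue X + ennreal \<epsilon>"
      using C U by (intro order_trans[OF nn_integral_disjoint_balls_le[of C U] U(3)]) (auto simp: K_def)
    also have "emeasure lebesgue X + ennreal \<epsilon> + 5 ^ DIM('a) * ennreal \<epsilon> = emeasure lebesgue X + ennreal ((1 + 5 ^ DIM('a)) * \<epsilon>)"
      using \<epsilon> by (simp add: ring_distribs ennreal_plus ennreal_mult add.assoc flip: ennreal_power)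
    finally show ?thesis
      by (simp add: add_left_mono add_right_mono mult_left_mono)
  qed
  show "hausdorff_delta DIM('a) \<delta> X \<le> emeasure lebesgue X"
  proof (rule ennreal_le_epsilon)
    fix e :: real assume "0 < e"
    have p: "0 < 1 + (5::real) ^ DIM('a)"
      by (simp add: add_pos_pos)
    show "hausdorff_delta DIM('a) \<delta> X \<le> emeasure lebesgue X + ennreal e"
      using *[of "e / (1 + 5 ^ DIM('a))"] \<open>0 < e\<close> p by simp
  qed
qed

section \<open>The segments between the boundary and its image\<close>

text \<open>
  The tube over \<open>E\<close> is covered by the tubes over the closures of \<open>B j \<inter> E\<close> when the \<open>B j\<close> cover \<open>E\<close>.
  Passing to closures makes the pieces compact and keeps them inside \<open>E\<close>, where the displacement is at
  most \<open>w\<close>, without increasing the diameters.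
\<close>

lemma emeasure_tube_le_hausdorff_measure:
  fixes M :: "real ^ 'n ^ 'n"
  assumes M: "\<And>x. norm (M *v x) \<le> norm x" and E: "compact E"
    and w: "\<And>a. a \<in> E \<Longrightarrow> norm (M *v a - a) \<le> w" and W: "0 \<le> w" "w < W"
  shows "emeasure lebesgue (tube M E) \<le> ennreal W * hausdorff_measure (CARD('n) - 1) E"
proof -
  let ?k = "CARD('n) - 1"
  let ?c = "isodiametric_const ?k"
  obtain \<delta> where \<delta>: "0 < \<delta>"
    "\<And>B r. compact B \<Longrightarrow> (\<And>a b. a \<in> B \<Longrightarrow> b \<in> B \<Longrightarrow> norm (a - b) \<le> r) \<Longrightarrow> 0 \<le> r \<Longrightarrow> r < \<delta> \<Longrightarrow>
        (\<And>a. a \<in> B \<Longrightarrow> norm (M *v a - a) \<le> w) \<Longrightarrow>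
        measure lebesgue (tube M B) \<le> W * (?c * r ^ ?k)"
    using measure_small_tube[OF M W] by blast
  have c: "0 < W * ?c"
    using W by simp
  let ?S = "{(\<Sum>j. if B j = {} then 0 else ennreal (diameter (B j) ^ ?k)) | B :: nat \<Rightarrow> (real ^ 'n) set.
            (\<forall>j. bounded (B j) \<and> diameter (B j) \<le> \<delta> / 2) \<and> E \<subseteq> (\<Union>j. B j)}"
  have cover: "emeasure lebesgue (tube M E) \<le> ennreal (W * ?c) * s" if "s \<in> ?S" for s
  proof -
    obtain B where s: "s = (\<Sum>j. if B j = {} then 0 else ennreal (diameter (B j) ^ ?k))"
      and B: "\<And>j. bounded (B j)" "\<And>j. diameter (B j) \<le> \<delta> / 2" "E \<subseteq> (\<Union>j::nat. B j)"
      using \<open>s \<in> ?S\<close> by blast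
    define K where "K j = closure (B j \<inter> E)" for j
    have K: "compact (K j)" "K j \<subseteq> E" for j
      using B(1)[of j] closure_minimal[OF _ compact_imp_closed[OF E], of "B j \<inter> E"]
      by (auto simp: K_def compact_closure bounded_Int)
    have diam: "norm (a - b) \<le> diameter (B j)" if "a \<in> K j" "b \<in> K j" for a b j
    proof -
      have "norm (a - b) \<le> diameter (K j)"
        using diameter_bounded_bound[OF compact_imp_bounded[OF K(1)] that] by (simp add: dist_norm)
      also have "\<dots> = diameter (B j \<inter> E)"
        using B(1)[of j] unfolding K_def by (intro diameter_closure) (simp add: bounded_Int)
      also have "\<dots> \<le> diameter (B j)"
        using B(1)[of j] by (intro diameter_subset) auto
      finally show ?thesis .
    qed
    have tube: "emeasure lebesgue (tube M (K j)) \<le>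
        ennreal (W * ?c) * (if B j = {} then 0 else ennreal (diameter (B j) ^ ?k))" for j
    proof (cases "B j = {}")
      case True
      then show ?thesis
        by (simp add: K_def tube_def)
    next
      case False
      have d: "0 \<le> diameter (B j)"
        using B(1) by (rule diameter_ge_0)
      have "emeasure lebesgue (tube M (K j)) = ennreal (measure lebesgue (tube M (K j)))"
        using lmeasurable_compact[OF compact_tube[OF K(1)]] by (rule emeasure_eq_measure2)
      also have "\<dots> \<le> ennreal (W * (?c * diameter (B j) ^ ?k))"
        using K[of j] w diam \<delta>(1) B(2)[of j] d by (intro ennreal_leI \<delta>(2)) auto
      also have "\<dots> = ennreal (W * ?c) * ennreal (diameter (B j) ^ ?k)"
        using d c by (subst ennreal_mult[symmetric]) (auto simp: mult.assoc)
      finally show ?thesis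
        using False by simp
    qed
    have "tube M E \<subseteq> (\<Union>j. tube M (K j))"
    proof -
      have "E = (\<Union>j. B j \<inter> E)"
        using B(3) by auto
      also have "\<dots> \<subseteq> (\<Union>j. K j)"
        unfolding K_def by (intro UN_mono order_refl closure_subset)
      finally have "E \<subseteq> (\<Union>j. K j)" .
      then have "tube M E \<subseteq> tube M (\<Union>j. K j)"
        unfolding tube_def by (rule UN_mono) (rule order_refl)
      also have "\<dots> = (\<Union>j. tube M (K j))"
        by (simp add: tube_def)
      finally show ?thesis .
    qed
    then have "emeasure lebesgue (tube M E) \<le> emeasure lebesgue (\<Union>j. tube M (K j))"
      using lmeasurable_compact[OF compact_tube[OF K(1)]] by (intro emeasure_mono) (auto simp: fmeasurableD)
    also have "\<dots> \<le> (\<Sum>j. emeasure lebesgue (tube M (K j)))"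
      using lmeasurable_compact[OF compact_tube[OF K(1)]]
      by (intro emeasure_subadditive_countably) (auto simp: fmeasurableD)
    also have "\<dots> \<le> (\<Sum>j. ennreal (W * ?c) * (if B j = {} then 0 else ennreal (diameter (B j) ^ ?k)))"
      by (intro suminf_le tube) auto
    also have "\<dots> = ennreal (W * ?c) * s"
      unfolding s by (rule ennreal_suminf_cmult)
    finally show ?thesis .
  qed
  \<comment> \<open>Multiplication by a positive real number is invertible, hence compatible with the infimum over
    all covers.\<close>
  have "ennreal q * (ennreal (1 / q) * x) = x" if "0 < q" for q x
    using that by (simp flip: mult.assoc ennreal_mult)
  note cancel = this[OF c]
  have "ennreal (1 / (W * ?c)) * emeasure lebesgue (tube M E) \<le> Inf ?S"
  proof (rule Inf_greatest)
    fix s assume "s \<in> ?S"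
    then have "ennreal (1 / (W * ?c)) * emeasure lebesgue (tube M E) \<le> ennreal (1 / (W * ?c)) * (ennreal (W * ?c) * s)"
      by (intro mult_left_mono cover) auto
    then show "ennreal (1 / (W * ?c)) * emeasure lebesgue (tube M E) \<le> s"
      unfolding mult.left_commute[of "ennreal (1 / (W * ?c))"] cancel .
  qed
  then have "ennreal (W * ?c) * (ennreal (1 / (W * ?c)) * emeasure lebesgue (tube M E)) \<le>
      ennreal (W * ?c) * Inf ?S"
    by (rule mult_left_mono) simp
  then have "emeasure lebesgue (tube M E) \<le> ennreal (W * ?c) * Inf ?S"
    unfolding cancel .
  also have "ennreal (W * ?c) = ennreal W * ennreal ?c"
    using W by (intro ennreal_mult) auto
  also have "ennreal W * ennreal ?c * Inf ?S = ennreal W * hausdorff_delta ?k (\<delta> / 2) E"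
    unfolding hausdorff_delta_def mult.assoc ..
  also have "\<dots> \<le> ennreal W * hausdorff_measure ?k E"
    unfolding hausdorff_measure_eq_SUP using \<delta>(1) by (intro mult_left_mono SUP_upper) auto
  finally show ?thesis .
qed

lemma norm_rotation_matrix:
  fixes M :: "real ^ 'n ^ 'n"
  assumes "rotation_matrix M"
  shows "norm (M *v x) = norm x"
proof -
  have "orthogonal_transformation ((*v) M)"
    using assms by (simp add: rotation_matrix_def orthogonal_transformation_matrix)
  then show ?thesis
    by (rule orthogonal_transformation_norm)
qed

theorem corollary11:
  fixes A :: "(real ^ 'n) set" and M :: "real ^ 'n ^ 'n" and w :: real
  assumes "bounded A"
    and "mu_rectifiable (hausdorff_measure (CARD('n) - 1)) (CARD('n) - 1) (frontier A)"
    and "rotation_matrix M"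
    and "w = (GREATEST r. r \<in> (\<lambda>a. norm (a - M *v a)) ` frontier A)"
  shows "hausdorff_measure (CARD('n)) (\<Union>a\<in>frontier A. closed_segment a (M *v a))
           \<le> ennreal w * hausdorff_measure (CARD('n) - 1) (frontier A)"
proof -
  let ?E = "frontier A"
  let ?H = "hausdorff_measure (CARD('n) - 1) ?E"
  have E: "compact ?E"
    using assms(1) by (rule compact_frontier_bounded)
  have M: "norm (M *v x) \<le> norm x" for x
    using norm_rotation_matrix[OF assms(3)] by simp
  have fin: "?H < \<infinity>"
    using assms(2) by (simp add: mu_rectifiable_def)
  have "hausdorff_measure (CARD('n)) (tube M ?E) \<le> emeasure lebesgue (tube M ?E)"
    using hausdorff_measure_le_lebesgue[OF fmeasurableD[OF lmeasurable_compact[OF compact_tube[OF E]]]] by simp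
  also have "\<dots> \<le> ennreal w * ?H"
  proof (cases "?E = {}")
    case True
    then show ?thesis
      by (simp add: tube_def)
  next
    case False
    \<comment> \<open>The maximum of the displacement is attained, so \<open>GREATEST\<close> denotes it.\<close>
    have "continuous_on ?E (\<lambda>a. norm (a - M *v a))"
      by (intro continuous_intros bounded_linear.continuous_on[OF matrix_vector_mul_bounded_linear])
    then obtain a where a: "a \<in> ?E" "\<And>b. b \<in> ?E \<Longrightarrow> norm (b - M *v b) \<le> norm (a - M *v a)"
      using continuous_attains_sup[OF E False] by blast
    have "w = norm (a - M *v a)"
      unfolding assms(4) using a by (intro Greatest_equality) auto
    then have w: "0 \<le> w" "\<And>b. b \<in> ?E \<Longrightarrow> norm (M *v b - b) \<le> w"
      using a by (auto simp: norm_minus_commute)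
    \<comment> \<open>Finiteness of the measure of the boundary allows the passage from \<open>W > w\<close> to \<open>w\<close>.\<close>
    obtain h where h: "?H = ennreal h" "0 \<le> h"
      using fin by (metis ennreal_cases infinity_ennreal_def less_irrefl)
    show ?thesis
      unfolding h(1)
    proof (rule tendsto_lowerbound)
      have "((\<lambda>W. ennreal (W * h)) \<longlongrightarrow> ennreal (w * h)) (at_right w)"
        by (intro tendsto_ennrealI tendsto_intros)
      then show "((\<lambda>W. ennreal W * ennreal h) \<longlongrightarrow> ennreal w * ennreal h) (at_right w)"
        using h(2) by (simp add: ennreal_mult'')
      have "emeasure lebesgue (tube M ?E) \<le> ennreal W * ennreal h" if "w < W" for W
        using emeasure_tube_le_hausdorff_measure[OF M E w(2) w(1) that] unfolding h(1) .
      then show "\<forall>\<^sub>F W in at_right w. emeasure lebesgue (tube M ?E) \<le> ennreal W * ennreal h"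
        by (intro eventually_at_right_less[THEN eventually_mono]) auto
    qed simp
  qed
  finally show ?thesis
    by (simp add: tube_def)
qed

end
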